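(* Let $n\in\mathbb{N}$, $\vartheta\in(0,1)$, $\alpha,\beta\in(0,1)$, and $\mathbf{a}\in\mathbb{R}^n_+$ with $\|\mathbf{a}\|=1$. The distribution $$w(\mathbf{x},t)=\int_0^\infty dz\int_{\mathbb{R}^n_+}d\mathbf{s}\;\mathcal{T}_{2\vartheta}(\mathbf{x}-\mathbf{s},z)\,h_\alpha(\mathbf{a}\cdot\mathbf{s},z)\,l_\beta(z,t)$$ is the law of the subordinated $\mathbb{R}^n$-valued stable process with stable subordinated drift $$\mathbf{W}(t)=\mathbf{S}_{2\vartheta}(\mathfrak{L}^\beta_t)+\mathbf{a}\,\mathfrak{H}^\alpha_{\mathfrak{L}^\beta_t},\qquad t>0,$$ whose characteristic function is $$\mathbb{E}\,e^{i\boldsymbol{\xi}\cdot\mathbf{W}(t)}=E_\beta\left(-t^\beta\|\boldsymbol{\xi}\|^{2\vartheta}-t^\beta(-i\boldsymbol{\xi}\cdot\mathbf{a})^\alpha\right),\qquad\boldsymbol{\xi}\in\mathbb{R}^n.$$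
   Context: $\mathbb{R}^n_+$ is the non-negative orthant and $\mathbf{a}\cdot\mathbf{x}=\sum_ka_kx_k$. $\mathbf{S}_{2\vartheta}(t)$ is the $\mathbb{R}^n$-valued isotropic stable L\'evy process with $\mathbb{E}e^{i\boldsymbol{\xi}\cdot\mathbf{S}_{2\vartheta}(t)}=e^{-t\|\boldsymbol{\xi}\|^{2\vartheta}}$ and density $\mathcal{T}_{2\vartheta}(\mathbf{x},t)$. $\mathfrak{H}^\alpha_t$ is the $\alpha$-stable subordinator with $\mathbb{E}e^{-\xi\mathfrak{H}^\alpha_t}=e^{-t\xi^\alpha}$ and density $h_\alpha(x,t)$. $\mathfrak{L}^\beta_t=\inf\{s\ge0:\mathfrak{H}^\beta_s\notin(0,t)\}$ is the inverse of a $\beta$-stable subordinator, with density $l_\beta(x,t)$. The processes $\mathbf{S}_{2\vartheta}$, $\mathfrak{H}^\alpha$ and $\mathfrak{L}^\beta$ are independent. $E_\beta(z)=\sum_{k\ge0}\frac{z^k}{\Gamma(\beta k+1)}$ is the Mittag-Leffler function, and powers $(-i\gamma)^\alpha$, $\gamma\in\mathbb{R}$, use the principal branch. Convention of the paper: since $\mathbf{s}=r\mathbf{a}$ is taken to be equivalent to $\mathbf{a}\cdot\mathbf{s}=r$, the distributions $\delta(\mathbf{s}-r\mathbf{a})$ and $\delta(\mathbf{a}\cdot\mathbf{s}-r)$ are identified, so that $h_\alpha(\mathbf{a}\cdot\mathbf{s},z)$, as a distribution in $\mathbf{s}\in\mathbb{R}^n_+$, stands for $\int_0^\infty h_\alp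ha(r,z)\,\delta(\mathbf{s}-r\mathbf{a})\,dr$.
   Formalization: The inverse subordinator is taken as the infimum over s > 0 rather than s ≥ 0: since the subordinator starts at 0, which is not in (0,t), the infimum over s ≥ 0 would be identically 0 and have no density. *)

theory Defs
  imports "HOL-Probability.Probability"
begin

section \<open>Processes\<close>

text \<open>Processes are indexed by all of \<open>real\<close>; only the values at times \<open>t \<ge> 0\<close> are meaningful,
  and no definition below constrains the others. Path properties are required almost surely.\<close>

definition cadlag :: "(real \<Rightarrow> 'b::topological_space) \<Rightarrow> bool" where
  "cadlag f \<longleftrightarrow> (\<forall>t\<ge>0. (f \<longlongrightarrow> f t) (at_right t)) \<and>
                (\<forall>t>0. \<exists>l. (f \<longlongrightarrow> l) (at_left t))"

definition levy_process :: "'w measure \<Rightarrow> (real \<Rightarrow> 'w \<Rightarrow> 'b::euclidean_space) \<Rightarrow> bool" where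
  "levy_process M X \<longleftrightarrow>
     (\<forall>t\<ge>0. X t \<in> borel_measurable M) \<and>
     (AE \<omega> in M. X 0 \<omega> = 0) \<and>
     (\<forall>(\<tau> :: nat \<Rightarrow> real) n. 0 \<le> \<tau> 0 \<longrightarrow> mono \<tau> \<longrightarrow>
        prob_space.indep_vars M (\<lambda>_. borel) (\<lambda>i \<omega>. X (\<tau> (Suc i)) \<omega> - X (\<tau> i) \<omega>) {..<n}) \<and>
     (\<forall>s\<ge>0. \<forall>t\<ge>0. distr M borel (\<lambda>\<omega>. X (s + t) \<omega> - X s \<omega>) = distr M borel (X t)) \<and>
     (AE \<omega> in M. cadlag (\<lambda>t. X t \<omega>))"

definition isotropic_stable_process ::
    "'w measure \<Rightarrow> real \<Rightarrow> (real \<Rightarrow> 'w \<Rightarrow> 'b::euclidean_space) \<Rightarrow> bool" where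
  "isotropic_stable_process M \<theta> S \<longleftrightarrow>
     levy_process M S \<and>
     (\<forall>t\<ge>0. \<forall>\<xi>. (\<integral>\<omega>. iexp (\<xi> \<bullet> S t \<omega>) \<partial>M) = complex_of_real (exp (- t * norm \<xi> powr (2 * \<theta>))))"

definition stable_subordinator :: "'w measure \<Rightarrow> real \<Rightarrow> (real \<Rightarrow> 'w \<Rightarrow> real) \<Rightarrow> bool" where
  "stable_subordinator M \<alpha> H \<longleftrightarrow>
     levy_process M H \<and>
     (AE \<omega> in M. mono_on {0..} (\<lambda>t. H t \<omega>)) \<and>
     (\<forall>t\<ge>0. \<forall>\<xi>\<ge>0. (\<integral>\<omega>. exp (- \<xi> * H t \<omega>) \<partial>M) = exp (- t * \<xi> powr \<alpha>))"

text \<open>The infimum is the first exit time from \<open>(0,t)\<close> of a subordinator started at the boundary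
  point \<open>0\<close>, so it runs over strictly positive times; with \<open>s = 0\<close> admitted it would vanish
  identically, because \<open>H 0 = 0\<close> does not lie in the open interval.\<close>

definition inverse_process :: "(real \<Rightarrow> 'w \<Rightarrow> real) \<Rightarrow> real \<Rightarrow> 'w \<Rightarrow> real" where
  "inverse_process H t \<omega> = Inf {s. 0 < s \<and> H s \<omega> \<notin> {0<..<t}}"

text \<open>The sigma-algebra generated by a process; independence of processes with different state
  spaces is independence of these families of events.\<close>

definition process_events :: "'w measure \<Rightarrow> (real \<Rightarrow> 'w \<Rightarrow> 'b::topological_space) \<Rightarrow> 'w set set" where
  "process_events M X =
     sigma_sets (space M) {X t -` A \<inter> space M | t A. 0 \<le> t \<and> A \<in> sets borel}"

definition independent_processes ::
    "'w measure \<Rightarrow> (real \<Rightarrow> 'w \<Rightarrow> 'b::topological_space) \<Rightarrow> (real \<Rightarrow> 'w \<Rightarrow> 'c::topological_space)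
       \<Rightarrow> (real \<Rightarrow> 'w \<Rightarrow> 'd::topological_space) \<Rightarrow> bool" where
  "independent_processes M X Y Z \<longleftrightarrow>
     prob_space.indep_sets M
       (\<lambda>i. [process_events M X, process_events M Y, process_events M Z] ! i) {..<3}"

text \<open>A density \<open>f x t\<close> of a process at times \<open>t > 0\<close>, in a version that is jointly measurable in
  \<open>x\<close> and \<open>t > 0\<close>, so that it can be integrated with respect to time.\<close>

definition has_process_density ::
    "'w measure \<Rightarrow> (real \<Rightarrow> 'w \<Rightarrow> 'b::euclidean_space) \<Rightarrow> ('b \<Rightarrow> real \<Rightarrow> ennreal) \<Rightarrow> bool" where
  "has_process_density M X f \<longleftrightarrow>
     case_prod f \<in> borel_measurable (borel \<Otimes>\<^sub>M restrict_space borel {0<..}) \<and>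
     (\<forall>t>0. distributed M lborel (X t) (\<lambda>x. f x t))"

section \<open>The distribution \<open>w\<close>\<close>

definition nonneg_orthant :: "(real ^ 'n) set" where
  "nonneg_orthant = {x. \<forall>k. 0 \<le> x $ k}"

text \<open>The distribution \<open>h(a \<bullet> s, z)\<close> in \<open>s\<close>, understood as
  \<open>\<integral> h(r, z) \<delta>(s - r a) dr\<close> over \<open>r > 0\<close>: the image of the measure \<open>h(r, z) dr\<close> on \<open>(0, \<infinity>)\<close> under
  \<open>r \<mapsto> r a\<close>.\<close>

definition ray_distribution ::
    "(real \<Rightarrow> real \<Rightarrow> ennreal) \<Rightarrow> real ^ 'n \<Rightarrow> real \<Rightarrow> (real ^ 'n) measure" where
  "ray_distribution h a z =
     distr (density lborel (\<lambda>r. h r z * indicator {0<..} r)) borel (\<lambda>r. r *\<^sub>R a)"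

definition w_distribution ::
    "(real ^ 'n \<Rightarrow> real \<Rightarrow> ennreal) \<Rightarrow> (real \<Rightarrow> real \<Rightarrow> ennreal) \<Rightarrow> (real \<Rightarrow> real \<Rightarrow> ennreal)
       \<Rightarrow> real ^ 'n \<Rightarrow> real ^ 'n \<Rightarrow> real \<Rightarrow> ennreal" where
  "w_distribution T h l a x t =
     (\<integral>\<^sup>+ z\<in>{0<..}.
        (\<integral>\<^sup>+ s\<in>nonneg_orthant. T (x - s) z * l z t \<partial>ray_distribution h a z) \<partial>lborel)"

definition mittag_leffler :: "real \<Rightarrow> complex \<Rightarrow> complex" where
  "mittag_leffler \<beta> z = (\<Sum>k. z ^ k / Gamma (complex_of_real (\<beta> * real k + 1)))"

end

theory Submission
  imports Defs "HOL-Complex_Analysis.Conformal_Mappings" "HOL-Real_Asymp.Real_Asymp"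
begin

text \<open>
Condition on the random time. The time \<open>L t\<close> is independent of the pair \<open>(S, H)\<close>, so \<open>W t\<close> is a mixture, over the
density \<open>l z t\<close> of \<open>L t\<close>, of the laws of \<open>S z + H z a\<close> at the fixed times \<open>z > 0\<close>. Each of these is the convolution of
\<open>T x z dx\<close> with the image of \<open>h r z dr\<close> on the ray spanned by \<open>a\<close>; mixing these convolutions gives
the density \<open>w\<close> (\<open>w_distribution_Tonelli\<close>).

For the characteristic function, independence of \<open>S\<close> and \<open>H\<close> at a fixed time gives
\<open>exp (- z \<parallel>\<xi>\<parallel> powr (2 \<theta>)) * exp (- z (- \<i> \<xi> \<bullet> a) powr \<alpha>) = exp (c z)\<close>. The second factor comes from analytic continuation of
the Laplace transform of the subordinator to the imaginary axis (\<open>char_of_stable_laplace\<close>). It remains to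
compute \<open>E (exp (c L t))\<close> for a complex number \<open>c\<close>. Since \<open>L t\<close> has the law of \<open>(t / K 1) powr \<beta>\<close>, its moments are negative
moments of a stable variable, namely \<open>k! t powr (\<beta> k) / Gamma (\<beta> k + 1)\<close>, and summing the exponential series gives
\<open>E\<^sub>\<beta> (c t powr \<beta>)\<close> (\<open>inverse_process_mittag_leffler\<close>).

Substituting a random time into a process requires joint measurability in time and \<open>\<omega>\<close>. The path
regularity holds only almost surely, so the processes are replaced by right limits along time grids
(\<open>right_limit_version\<close>). These are jointly measurable and, almost surely, agree with the processes at all
nonnegative times. This is also why the law of \<open>W t\<close> is taken with respect to the completed measure.
\<close>

section \<open>From the Laplace transform to the characteristic function\<close>

text \<open>The domination under which \<open>X \<mapsto> exp (- z X)\<close> may be differentiated in \<open>z\<close> inside an expectation: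
with \<open>r = Re z / 2\<close> the right-hand side is compensated exactly by \<open>exp (- Re z x)\<close>.\<close>

lemma exp_difference_quotient_bound:
  fixes h :: complex and x r :: real
  assumes "0 \<le> x" "h \<noteq> 0" "norm h \<le> r" "0 < r"
  shows "norm ((exp (- (h * of_real x)) - 1) / h) \<le> exp (2 * r * x) / r"
proof -
  have "norm (exp (- (h * of_real x)) - 1) \<le> exp (norm h * x) * (norm h * x)"
    using Taylor_exp_field[of "- (h * of_real x)" 0] assms(1) by (simp add: norm_mult)
  also have "\<dots> = norm h * x * exp (norm h * x)" by simp
  also have "\<dots> \<le> norm h * (x * exp (r * x))"
    using assms by (auto intro!: mult_left_mono mult_right_mono simp: mult.assoc)
  finally have "norm ((exp (- (h * of_real x)) - 1) / h) \<le> x * exp (r * x)"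
    using assms by (simp add: norm_divide field_simps)
  also have "r * x \<le> exp (r * x)" using exp_ge_add_one_self[of "r * x"] by linarith
  then have "x \<le> exp (r * x) / r" using assms by (simp add: field_simps)
  then have "x * exp (r * x) \<le> exp (r * x) / r * exp (r * x)" by (intro mult_right_mono) auto
  also have "\<dots> = exp (2 * r * x) / r" by (simp flip: exp_add)
  finally show ?thesis .
qed

lemma (in prob_space) laplace_transform_holomorphic:
  fixes X :: "'a \<Rightarrow> real"
  assumes [measurable]: "X \<in> borel_measurable M" and nn: "AE \<omega> in M. 0 \<le> X \<omega>"
  shows "(\<lambda>z. \<integral>\<omega>. exp (- (z * complex_of_real (X \<omega>))) \<partial>M) holomorphic_on {z. 0 < Re z}"
proof (rule holomorphic_onI)
  fix z assume "z \<in> {z. 0 < Re z}"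
  then have z: "0 < Re z" by simp
  let ?F = "\<lambda>z. \<integral>\<omega>. exp (- (z * complex_of_real (X \<omega>))) \<partial>M"
  have int: "integrable M (\<lambda>\<omega>. exp (- (w * complex_of_real (X \<omega>))))" if "0 < Re w" for w
    using that nn by (intro integrable_const_bound[where B=1]) (auto elim!: eventually_mono)
  define D where "D = (\<integral>\<omega>. - of_real (X \<omega>) * exp (- (z * complex_of_real (X \<omega>))) \<partial>M)"
  have "((\<lambda>h. (?F (z + h) - ?F z) / h) \<longlongrightarrow> D) (at 0)"
    unfolding tendsto_at_iff_sequentially comp_def
  proof (intro allI impI)
    fix s :: "nat \<Rightarrow> complex" assume s: "\<forall>i. s i \<in> UNIV - {0}" "s \<longlonglongrightarrow> 0"
    define r where "r = Re z / 2"
    have r: "0 < r" using z by (simp add: r_def)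
    obtain N where N: "\<And>n. n \<ge> N \<Longrightarrow> norm (s n) < r"
      using LIMSEQ_D[OF s(2) r] by auto
    have q: "(?F (z + s (n + N)) - ?F z) / s (n + N)
      = (\<integral>\<omega>. exp (- (z * complex_of_real (X \<omega>)))
            * ((exp (- (s (n + N) * of_real (X \<omega>))) - 1) / s (n + N)) \<partial>M)" for n
    proof -
      have "norm (s (n + N)) < Re z" using N[of "n + N"] z by (simp add: r_def)
      then have "0 < Re (z + s (n + N))"
        using abs_Re_le_cmod[of "s (n + N)"] by (simp add: abs_le_iff)
      from int[OF this] int[OF z] show ?thesis
        by (subst Bochner_Integration.integral_diff[symmetric])
           (auto simp flip: Bochner_Integration.integral_divide_zero
             intro!: Bochner_Integration.integral_cong simp: field_simps exp_add exp_diff exp_minus)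
    qed
    have "(\<lambda>n. (?F (z + s (n + N)) - ?F z) / s (n + N)) \<longlonglongrightarrow> D"
      unfolding q D_def
    proof (rule integral_dominated_convergence[where w="\<lambda>_. 1 / r"])
      show "AE \<omega> in M. (\<lambda>n. exp (- (z * complex_of_real (X \<omega>)))
            * ((exp (- (s (n + N) * of_real (X \<omega>))) - 1) / s (n + N)))
         \<longlonglongrightarrow> - of_real (X \<omega>) * exp (- (z * complex_of_real (X \<omega>)))"
      proof (rule AE_I2)
        fix \<omega>
        have "((\<lambda>h. exp (- (h * complex_of_real (X \<omega>)))) has_field_derivative - of_real (X \<omega>)) (at 0)"
          by (auto intro!: derivative_eq_intros)
        then have "((\<lambda>h. (exp (- (h * complex_of_real (X \<omega>))) - 1) / h) \<longlongrightarrow> - of_real (X \<omega>)) (at 0)"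
          by (simp add: has_field_derivative_iff)
        then have "(\<lambda>n. (exp (- (s (n + N) * complex_of_real (X \<omega>))) - 1) / s (n + N)) \<longlonglongrightarrow> - of_real (X \<omega>)"
          unfolding tendsto_at_iff_sequentially comp_def using s(1) LIMSEQ_ignore_initial_segment[OF s(2)]
          by (elim allE[of _ "\<lambda>n. s (n + N)"]) auto
        from tendsto_mult[OF tendsto_const[of "exp (- (z * complex_of_real (X \<omega>)))"] this]
        show "(\<lambda>n. exp (- (z * complex_of_real (X \<omega>)))
            * ((exp (- (s (n + N) * of_real (X \<omega>))) - 1) / s (n + N)))
         \<longlonglongrightarrow> - of_real (X \<omega>) * exp (- (z * complex_of_real (X \<omega>)))" by (simp add: mult.commute)
      qed
      fix n
      show "AE \<omega> in M. norm (exp (- (z * complex_of_real (X \<omega>)))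
            * ((exp (- (s (n + N) * of_real (X \<omega>))) - 1) / s (n + N))) \<le> 1 / r"
        using nn
      proof eventually_elim
        case (elim \<omega>)
        have "norm (exp (- (z * complex_of_real (X \<omega>)))
            * ((exp (- (s (n + N) * of_real (X \<omega>))) - 1) / s (n + N)))
          \<le> exp (- (Re z * X \<omega>)) * (exp (2 * r * X \<omega>) / r)"
          unfolding norm_mult using elim s(1) N[of "n + N"] r
          by (intro mult_mono exp_difference_quotient_bound) auto
        also have "\<dots> = 1 / r" by (simp add: r_def flip: exp_add)
        finally show ?case .
      qed
    qed simp_all
    then show "(\<lambda>n. (?F (z + s n) - ?F z) / s n) \<longlonglongrightarrow> D" by (rule LIMSEQ_offset)
  qed
  then have "(?F has_field_derivative D) (at z)"
    by (simp add: DERIV_def)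
  then show "?F field_differentiable at z within {z. 0 < Re z}"
    using field_differentiable_at_within field_differentiable_def by blast
qed

text \<open>The characteristic function is the boundary value at \<open>z = - \<i> \<xi>\<close> of the Laplace transform
\<open>z \<mapsto> E (exp (- z X))\<close>. In the open right half-plane the transform is holomorphic and agrees with
\<open>exp (- c z powr b)\<close> on the positive axis, hence everywhere by the identity theorem. The boundary
is approached along \<open>1 / Suc n - \<i> \<xi>\<close>; there \<open>powr\<close> is continuous because \<open>- \<i> \<xi>\<close> does not lie on its
branch cut when \<open>\<xi> \<noteq> 0\<close>.\<close>

lemma (in prob_space) char_of_stable_laplace:
  fixes X :: "'a \<Rightarrow> real"
  assumes [measurable]: "X \<in> borel_measurable M" and nn: "AE \<omega> in M. 0 \<le> X \<omega>"
    and b: "0 < b"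
    and lap: "\<And>\<xi>. 0 < \<xi> \<Longrightarrow> (\<integral>\<omega>. exp (- \<xi> * X \<omega>) \<partial>M) = exp (- c * \<xi> powr b)"
  shows "(\<integral>\<omega>. iexp (\<xi> * X \<omega>) \<partial>M) = exp (- of_real c * (- \<i> * of_real \<xi>) powr of_real b)"
proof (cases "\<xi> = 0")
  case True
  then show ?thesis using b by (simp add: prob_space)
next
  case False
  let ?F = "\<lambda>z. \<integral>\<omega>. exp (- (z * complex_of_real (X \<omega>))) \<partial>M"
  let ?G = "\<lambda>z. exp (- of_real c * z powr complex_of_real b)"
  have eq: "?F z = ?G z" if z: "0 < Re z" for z
  proof -
    have "?F z - ?G z = 0"
    proof (rule analytic_continuation[where f="\<lambda>z. ?F z - ?G z" and S="{z. 0 < Re z}" and U="complex_of_real ` {0<..}" and \<xi>=1])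
      show "(\<lambda>z. ?F z - ?G z) holomorphic_on {z. 0 < Re z}"
        by (intro holomorphic_intros laplace_transform_holomorphic nn)
           (auto simp: complex_nonpos_Reals_iff)
      show "open {z. 0 < Re z}" by (rule open_halfspace_Re_gt)
      show "connected {z. 0 < Re z}" by (intro convex_connected convex_halfspace_Re_gt)
      show "complex_of_real ` {0<..} \<subseteq> {z. 0 < Re z}" "1 \<in> {z. 0 < Re z}" by auto
      have "(1::real) islimpt {0<..}" by (rule open_imp_islimpt) auto
      then show "1 islimpt complex_of_real ` {0<..}"
        using islimpt_isCont_image[of "1::real" "{0<..}" complex_of_real]
        by (auto simp: eventually_at_filter)
      show "?F z - ?G z = 0" if "z \<in> complex_of_real ` {0<..}" for z
      proof -
        obtain x where x: "z = of_real x" "0 < x" using \<open>z \<in> complex_of_real ` {0<..}\<close> by auto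
        have "?F z = (\<integral>\<omega>. complex_of_real (exp (- x * X \<omega>)) \<partial>M)"
          by (simp add: x flip: exp_of_real)
        also have "\<dots> = of_real (exp (- c * x powr b))"
          unfolding integral_complex_of_real using lap[OF x(2)] by simp
        also have "\<dots> = ?G z" using x by (simp add: powr_of_real flip: exp_of_real)
        finally show ?thesis by simp
      qed
      show "z \<in> {z. 0 < Re z}" using z by simp
    qed
    then show ?thesis by simp
  qed
  define w where "w n = complex_of_real (inverse (real (Suc n))) - \<i> * of_real \<xi>" for n
  have w: "w \<longlonglongrightarrow> - \<i> * of_real \<xi>"
    unfolding w_def
    using tendsto_diff[OF tendsto_of_real[OF LIMSEQ_inverse_real_of_nat, where 'a=complex]
        tendsto_const[of "\<i> * of_real \<xi>"]] by simp
  have "(\<lambda>n. ?F (w n)) \<longlonglongrightarrow> (\<integral>\<omega>. iexp (\<xi> * X \<omega>) \<partial>M)"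
  proof (rule integral_dominated_convergence[where w="\<lambda>_. 1"])
    show "AE \<omega> in M. (\<lambda>n. exp (- (w n * complex_of_real (X \<omega>)))) \<longlonglongrightarrow> iexp (\<xi> * X \<omega>)"
    proof (rule AE_I2)
      fix \<omega>
      show "(\<lambda>n. exp (- (w n * complex_of_real (X \<omega>)))) \<longlonglongrightarrow> iexp (\<xi> * X \<omega>)"
        using tendsto_exp[OF tendsto_minus[OF tendsto_mult[OF w tendsto_const[of "of_real (X \<omega>)"]]]]
        by (simp add: mult_ac)
    qed
    show "AE \<omega> in M. norm (exp (- (w n * complex_of_real (X \<omega>)))) \<le> 1" for n
      using nn by eventually_elim (simp add: w_def)
  qed simp_all
  moreover have "(\<lambda>n. ?F (w n)) \<longlonglongrightarrow> ?G (- \<i> * of_real \<xi>)"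
  proof -
    have "?F (w n) = ?G (w n)" for n by (rule eq) (simp add: w_def)
    moreover have "(\<lambda>n. ?G (w n)) \<longlonglongrightarrow> ?G (- \<i> * of_real \<xi>)"
      using False w by (intro tendsto_intros) (auto simp: complex_nonpos_Reals_iff)
    ultimately show ?thesis by simp
  qed
  ultimately show ?thesis by (rule LIMSEQ_unique)
qed

section \<open>Mittag-Leffler moments\<close>

text \<open>Restrict Euler's integral for \<open>Gamma (x + 1)\<close> to \<open>[R, \<infinity>)\<close> and bound the power below by \<open>R powr x\<close>. As \<open>R\<close>
is free, the bound makes \<open>Gamma (b k + 1)\<close> outgrow every geometric sequence in \<open>k\<close>.\<close>

lemma powr_times_exp_le_Gamma:
  assumes "0 < R" "0 \<le> x"
  shows "R powr x * exp (- R) \<le> Gamma (x + 1 :: real)"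
proof (rule has_integral_le)
  show "((\<lambda>t. if t \<in> {R..} then R powr x * exp (- 1 * t) else 0) has_integral R powr x * exp (- R)) {0..}"
    using has_integral_mult_right[OF has_integral_exp_minus_to_infinity[of 1 R], of "R powr x"] assms
    by (subst has_integral_restrict) auto
  show "((\<lambda>t. t powr (x + 1 - 1) / exp t) has_integral Gamma (x + 1)) {0..}"
    using assms by (intro Gamma_integral_real) auto
  show "(if t \<in> {R..} then R powr x * exp (- 1 * t) else 0) \<le> t powr (x + 1 - 1) / exp t"
    if "t \<in> {0..}" for t
    using assms by (auto simp: exp_minus field_simps intro!: powr_mono2)
qed

lemma summable_mittag_leffler:
  fixes r b :: real
  assumes r: "0 \<le> r" and b: "0 < b"
  shows "summable (\<lambda>k. r ^ k / Gamma (b * real k + 1))"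
proof (rule summable_comparison_test')
  \<comment> \<open>\<open>R powr b\<close> exceeds \<open>2 r\<close>, so the terms decay like \<open>(1 / 2) ^ k\<close>; the \<open>+ 1\<close> covers \<open>r = 0\<close>.\<close>
  define R where "R = (2 * r + 1) powr (1 / b)"
  have R: "0 < R" "R powr b = 2 * r + 1" using r b by (auto simp: R_def powr_powr)
  show "summable (\<lambda>k. exp R * (1 / 2 :: real) ^ k)" by (intro summable_mult summable_geometric) auto
  fix k :: nat assume "k \<ge> 0"
  have "R powr (b * real k) = (2 * r + 1) ^ k"
    using R r by (simp add: powr_powr[symmetric] powr_realpow[of "2 * r + 1"])
  then have "(2 * r) ^ k * exp (- R) \<le> R powr (b * real k) * exp (- R)"
    using power_mono[of "2 * r" "2 * r + 1" k] r by simp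
  also have "\<dots> \<le> Gamma (b * real k + 1)" using b R by (intro powr_times_exp_le_Gamma) auto
  finally have "r ^ k \<le> exp R * (1 / 2) ^ k * Gamma (b * real k + 1)"
    by (simp add: exp_minus field_simps power_mult_distrib)
  moreover have "0 < Gamma (b * real k + 1)" using b by (intro Gamma_real_pos) (simp add: add_nonneg_pos)
  ultimately show "norm (r ^ k / Gamma (b * real k + 1)) \<le> exp R * (1 / 2) ^ k"
    using r by (simp add: field_simps)
qed

text \<open>Up to the scaling by \<open>s\<close>, the Mittag-Leffler function is the moment generating function of the law with
these moments: expand the exponential and integrate termwise. Exchanging sum and expectation
is allowed for every complex \<open>z\<close>, since the series of the norms is again a Mittag-Leffler series.\<close>

lemma (in prob_space) expectation_exp_mittag_leffler:
  fixes Y :: "'a \<Rightarrow> real" and s b :: real and z :: complex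
  assumes [measurable]: "Y \<in> borel_measurable M" and nn: "AE \<omega> in M. 0 \<le> Y \<omega>"
    and s: "0 \<le> s" and b: "0 < b"
    and moments: "\<And>k. (\<integral>\<^sup>+\<omega>. ennreal (Y \<omega> ^ k) \<partial>M) = ennreal (fact k * s ^ k / Gamma (b * real k + 1))"
  shows "(\<integral>\<omega>. exp (z * of_real (Y \<omega>)) \<partial>M) = mittag_leffler b (z * of_real s)"
proof -
  have G: "0 < Gamma (b * real k + 1)" for k using b by (intro Gamma_real_pos) (simp add: add_nonneg_pos)
  have nn': "AE \<omega> in M. 0 \<le> Y \<omega> ^ k" for k using nn by eventually_elim simp
  have int: "integrable M (\<lambda>\<omega>. Y \<omega> ^ k)" for k
    using nn' by (intro integrableI_nonneg) (auto simp: moments)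
  have mom: "(\<integral>\<omega>. Y \<omega> ^ k \<partial>M) = fact k * s ^ k / Gamma (b * real k + 1)" for k
    using nn' G s by (subst integral_eq_nn_integral) (auto simp: moments less_imp_le)
  define f where "f k \<omega> = z ^ k / fact k * complex_of_real (Y \<omega> ^ k)" for k \<omega>
  have int_f: "integrable M (f k)" for k
    unfolding f_def by (intro integrable_mult_right integrable_of_real int)
  have "(\<integral>\<omega>. norm (f k \<omega>) \<partial>M) = (norm z * s) ^ k / Gamma (b * real k + 1)" for k
  proof -
    have "(\<integral>\<omega>. norm (f k \<omega>) \<partial>M) = (\<integral>\<omega>. norm z ^ k / fact k * Y \<omega> ^ k \<partial>M)"
    proof (rule integral_cong_AE)
      show "AE \<omega> in M. norm (f k \<omega>) = norm z ^ k / fact k * Y \<omega> ^ k"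
        using nn by eventually_elim (simp add: f_def norm_mult norm_divide norm_power)
    qed (use int_f in auto)
    also have "\<dots> = (norm z * s) ^ k / Gamma (b * real k + 1)"
      by (simp add: mom power_mult_distrib)
    finally show ?thesis .
  qed
  then have "summable (\<lambda>k. \<integral>\<omega>. norm (f k \<omega>) \<partial>M)"
    using summable_mittag_leffler[of "norm z * s" b] s b by simp
  moreover have "AE \<omega> in M. summable (\<lambda>k. norm (f k \<omega>))"
  proof (rule AE_I2)
    fix \<omega>
    have "summable (\<lambda>k. norm ((z * of_real (Y \<omega>)) ^ k /\<^sub>R fact k))"
      by (rule summable_norm_exp)
    then show "summable (\<lambda>k. norm (f k \<omega>))"
      by (simp add: f_def norm_mult norm_divide norm_power power_mult_distrib divide_simps)
  qed
  ultimately have "(\<integral>\<omega>. (\<Sum>k. f k \<omega>) \<partial>M) = (\<Sum>k. integral\<^sup>L M (f k))"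
    using int_f by (intro integral_suminf) auto
  also have "(\<lambda>\<omega>. \<Sum>k. f k \<omega>) = (\<lambda>\<omega>. exp (z * of_real (Y \<omega>)))"
    by (auto simp: f_def exp_def power_mult_distrib scaleR_conv_of_real divide_simps fun_eq_iff)
  finally have "(\<integral>\<omega>. exp (z * of_real (Y \<omega>)) \<partial>M) = (\<Sum>k. integral\<^sup>L M (f k))" .
  moreover have "integral\<^sup>L M (f k) = (z * of_real s) ^ k / Gamma (complex_of_real (b * real k + 1))" for k
    unfolding f_def Bochner_Integration.integral_mult_right_zero integral_complex_of_real mom
    by (simp add: Gamma_complex_of_real[symmetric] power_mult_distrib)
  ultimately show ?thesis by (simp add: mittag_leffler_def)
qed

lemma nn_integral_Gamma_scaled:
  assumes x: "0 < x" and p: "0 < p"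
  shows "(\<integral>\<^sup>+\<xi>. ennreal (indicator {0..} \<xi> * \<xi> powr (p - 1) * exp (- \<xi> * x)) \<partial>lborel)
    = ennreal (Gamma p * x powr (- p))"
proof -
  have "ennreal (Gamma p) = (\<integral>\<^sup>+t. ennreal (indicator {0..} t * t powr (p - 1) / exp t) \<partial>lborel)"
    by (rule Gamma_conv_nn_integral_real[OF p])
  also have "\<dots> = ennreal x * (\<integral>\<^sup>+\<xi>. ennreal (indicator {0..} (x * \<xi>) * (x * \<xi>) powr (p - 1) / exp (x * \<xi>)) \<partial>lborel)"
    using x by (subst nn_integral_real_affine[where c=x and t=0]) auto
  also have "\<dots> = (\<integral>\<^sup>+\<xi>. ennreal (x powr p) * ennreal (indicator {0..} \<xi> * \<xi> powr (p - 1) * exp (- \<xi> * x)) \<partial>lborel)"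
  proof (subst nn_integral_cmult[symmetric], simp, intro nn_integral_cong)
    fix \<xi> :: real
    have "x * ((x * \<xi>) powr (p - 1) / exp (x * \<xi>)) = x powr p * (\<xi> powr (p - 1) * exp (- \<xi> * x))" if "0 \<le> \<xi>"
      using x that by (simp add: powr_mult powr_diff exp_minus field_simps)
    then show "ennreal x * ennreal (indicator {0..} (x * \<xi>) * (x * \<xi>) powr (p - 1) / exp (x * \<xi>))
      = ennreal (x powr p) * ennreal (indicator {0..} \<xi> * \<xi> powr (p - 1) * exp (- \<xi> * x))"
      using x by (auto simp: indicator_def zero_le_mult_iff simp flip: ennreal_mult)
  qed
  also have "\<dots> = ennreal (x powr p) * (\<integral>\<^sup>+\<xi>. ennreal (indicator {0..} \<xi> * \<xi> powr (p - 1) * exp (- \<xi> * x)) \<partial>lborel)"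
    by (rule nn_integral_cmult) simp
  finally have "ennreal (x powr (- p)) * ennreal (Gamma p) = ennreal (x powr (- p)) * (ennreal (x powr p) * (\<integral>\<^sup>+\<xi>. ennreal (indicator {0..} \<xi> * \<xi> powr (p - 1) * exp (- \<xi> * x)) \<partial>lborel))"
    by simp
  also have "\<dots> = ennreal (x powr (- p) * x powr p) * (\<integral>\<^sup>+\<xi>. ennreal (indicator {0..} \<xi> * \<xi> powr (p - 1) * exp (- \<xi> * x)) \<partial>lborel)"
    by (simp add: ennreal_mult mult.assoc)
  also have "x powr (- p) * x powr p = 1" using x by (simp flip: powr_add)
  finally show ?thesis using p by (simp add: ennreal_mult'[symmetric] mult.commute Gamma_real_nonneg less_imp_le)
qed

text \<open>Euler's integral for \<open>Gamma (p / b)\<close> after the substitution \<open>u = \<xi> powr b\<close>.\<close>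

lemma nn_integral_powr_exp_powr:
  assumes b: "0 < b" and p: "0 < p"
  shows "(\<integral>\<^sup>+\<xi>. ennreal (indicator {0<..} \<xi> * (\<xi> powr (p - 1) * exp (- (\<xi> powr b)))) \<partial>lborel)
    = ennreal (Gamma (p / b) / b)"
proof -
  let ?f = "\<lambda>u. u powr (p / b - 1) / exp u :: real"
  have q: "0 < p / b" using b p by simp
  have "(?f has_integral Gamma (p / b)) {0..} \<longleftrightarrow> (?f has_integral Gamma (p / b)) {0<..}"
    by (rule has_integral_spike_set_eq; rule negligible_subset[of "{0}"]; force)
  with Gamma_integral_real[OF q] have hi: "(?f has_integral Gamma (p / b)) {0<..}" by simp
  have img: "(\<lambda>\<xi>. \<xi> powr b) ` {0<..} = {0<..}"
  proof safe
    fix u :: real assume "0 < u"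
    then show "u \<in> (\<lambda>\<xi>. \<xi> powr b) ` {0<..}"
      using b by (intro image_eqI[of _ _ "u powr (1 / b)"]) (auto simp: powr_powr)
  qed auto
  have "(\<lambda>\<xi>. \<bar>b * \<xi> powr (b - 1)\<bar> * ?f (\<xi> powr b)) absolutely_integrable_on {0<..} \<and>
    integral {0<..} (\<lambda>\<xi>. \<bar>b * \<xi> powr (b - 1)\<bar> * ?f (\<xi> powr b)) = Gamma (p / b) \<longleftrightarrow>
    ?f absolutely_integrable_on ((\<lambda>\<xi>. \<xi> powr b) ` {0<..}) \<and> integral ((\<lambda>\<xi>. \<xi> powr b) ` {0<..}) ?f = Gamma (p / b)"
  proof (rule has_absolute_integral_change_of_variables_1')
    show "((\<lambda>\<xi>. \<xi> powr b) has_real_derivative b * \<xi> powr (b - 1)) (at \<xi> within {0<..})"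
      if "\<xi> \<in> {0<..}" for \<xi>
      using that by (auto intro!: has_real_derivative_powr[THEN has_field_derivative_at_within])
    show "inj_on (\<lambda>\<xi>. \<xi> powr b) {0<..}"
      using b by (intro inj_on_inverseI[where g="\<lambda>u. u powr (1 / b)"]) (auto simp: powr_powr)
  qed simp
  moreover have "?f absolutely_integrable_on {0<..}"
    using hi by (intro nonnegative_absolutely_integrable_1) (auto simp: has_integral_integrable)
  ultimately have "(\<lambda>\<xi>. \<bar>b * \<xi> powr (b - 1)\<bar> * ?f (\<xi> powr b)) absolutely_integrable_on {0<..}"
    "integral {0<..} (\<lambda>\<xi>. \<bar>b * \<xi> powr (b - 1)\<bar> * ?f (\<xi> powr b)) = Gamma (p / b)"
    using hi unfolding img by (auto simp: integral_unique)
  then have "((\<lambda>\<xi>. \<bar>b * \<xi> powr (b - 1)\<bar> * ?f (\<xi> powr b)) has_integral Gamma (p / b)) {0<..}"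
    using integrable_integral[OF set_lebesgue_integral_eq_integral(1)] by fastforce
  from has_integral_mult_right[OF this, of "1 / b"]
  have "((\<lambda>\<xi>. \<xi> powr (p - 1) * exp (- (\<xi> powr b))) has_integral 1 / b * Gamma (p / b)) {0<..}"
  proof (rule has_integral_eq[rotated])
    show "1 / b * (\<bar>b * \<xi> powr (b - 1)\<bar> * ?f (\<xi> powr b)) = \<xi> powr (p - 1) * exp (- (\<xi> powr b))"
      if "\<xi> \<in> {0<..}" for \<xi>
    proof -
      have "\<xi> powr (b - 1) * (\<xi> powr b) powr (p / b - 1) = \<xi> powr (p - 1)"
        using b by (simp add: powr_powr algebra_simps flip: powr_add)
      then show ?thesis using that b by (simp add: exp_minus divide_inverse mult.assoc[symmetric])
    qed
  qed
  from nn_integral_has_integral_lebesgue[OF _ this] show ?thesis by (simp add: divide_inverse mult.commute)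
qed

text \<open>Write \<open>Gamma p X powr (- p)\<close> as the integral of \<open>\<xi> powr (p - 1) exp (- \<xi> X)\<close> over \<open>\<xi> > 0\<close> and exchange it with the
expectation: only the Laplace transform of \<open>X\<close> remains. This reads off the moments of the
inverse process without knowing the stable density.\<close>

lemma (in prob_space) stable_negative_moment:
  fixes X :: "'a \<Rightarrow> real"
  assumes [measurable]: "X \<in> borel_measurable M" and pos: "AE \<omega> in M. 0 < X \<omega>"
    and b: "0 < b" and p: "0 < p"
    and lap: "\<And>\<xi>. 0 < \<xi> \<Longrightarrow> (\<integral>\<omega>. exp (- \<xi> * X \<omega>) \<partial>M) = exp (- (\<xi> powr b))"
  shows "(\<integral>\<^sup>+\<omega>. ennreal (X \<omega> powr (- p)) \<partial>M) = ennreal (Gamma (p / b) / (b * Gamma p))"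
proof -
  interpret pair_sigma_finite M lborel ..
  have G: "0 < Gamma p" using p by (rule Gamma_real_pos)
  have "ennreal (Gamma p) * (\<integral>\<^sup>+\<omega>. ennreal (X \<omega> powr (- p)) \<partial>M)
    = (\<integral>\<^sup>+\<omega>. ennreal (Gamma p * X \<omega> powr (- p)) \<partial>M)"
    using G by (subst nn_integral_cmult[symmetric]) (auto simp: ennreal_mult')
  also have "\<dots> = (\<integral>\<^sup>+\<omega>. (\<integral>\<^sup>+\<xi>. ennreal (indicator {0..} \<xi> * \<xi> powr (p - 1) * exp (- \<xi> * X \<omega>)) \<partial>lborel) \<partial>M)"
    using pos by (intro nn_integral_cong_AE, eventually_elim) (rule nn_integral_Gamma_scaled[OF _ p, symmetric])
  also have "\<dots> = (\<integral>\<^sup>+\<xi>. (\<integral>\<^sup>+\<omega>. ennreal (indicator {0..} \<xi> * \<xi> powr (p - 1) * exp (- \<xi> * X \<omega>)) \<partial>M) \<partial>lborel)"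
    by (rule Fubini'[symmetric]) simp
  also have "\<dots> = (\<integral>\<^sup>+\<xi>. ennreal (indicator {0<..} \<xi> * (\<xi> powr (p - 1) * exp (- (\<xi> powr b)))) \<partial>lborel)"
  proof (rule nn_integral_cong_AE, rule AE_mp[OF AE_lborel_singleton[of 0]], intro AE_I2 impI)
    fix \<xi> :: real assume "\<xi> \<noteq> 0"
    show "(\<integral>\<^sup>+\<omega>. ennreal (indicator {0..} \<xi> * \<xi> powr (p - 1) * exp (- \<xi> * X \<omega>)) \<partial>M)
      = ennreal (indicator {0<..} \<xi> * (\<xi> powr (p - 1) * exp (- (\<xi> powr b))))"
    proof (cases "0 < \<xi>")
      case True
      have "integrable M (\<lambda>\<omega>. exp (- \<xi> * X \<omega>))"
        using pos True by (intro integrable_const_bound[where B=1]) (auto elim!: eventually_mono)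
      then have "(\<integral>\<^sup>+\<omega>. ennreal (exp (- \<xi> * X \<omega>)) \<partial>M) = ennreal (exp (- (\<xi> powr b)))"
        using lap[OF True] by (subst nn_integral_eq_integral) simp_all
      then show ?thesis using True
        by (simp add: ennreal_mult' nn_integral_cmult)
    qed (use \<open>\<xi> \<noteq> 0\<close> in auto)
  qed
  also have "\<dots> = ennreal (Gamma (p / b) / b)" by (rule nn_integral_powr_exp_powr[OF b p])
  finally have "ennreal (1 / Gamma p) * (ennreal (Gamma p) * (\<integral>\<^sup>+\<omega>. ennreal (X \<omega> powr (- p)) \<partial>M))
    = ennreal (1 / Gamma p) * ennreal (Gamma (p / b) / b)" by simp
  moreover have "ennreal (1 / Gamma p) * ennreal (Gamma p) = 1"
    using G by (simp flip: ennreal_mult')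
  moreover have "ennreal (1 / Gamma p) * ennreal (Gamma (p / b) / b) = ennreal (Gamma (p / b) / (b * Gamma p))"
    using G by (subst ennreal_mult'[symmetric]) (auto simp: mult.commute)
  ultimately show ?thesis by (metis mult.assoc mult_1)
qed

section \<open>The inverse of a stable subordinator\<close>

lemma stable_subordinator_nonneg:
  assumes "stable_subordinator M b K" "0 \<le> s"
  shows "AE \<omega> in M. 0 \<le> K s \<omega>"
proof -
  have "AE \<omega> in M. K 0 \<omega> = 0" "AE \<omega> in M. mono_on {0..} (\<lambda>t. K t \<omega>)"
    using assms by (auto simp: stable_subordinator_def levy_process_def)
  then show ?thesis
  proof eventually_elim
    case (elim \<omega>)
    have "K 0 \<omega> \<le> K s \<omega>" using mono_onD[OF elim(2), of 0 s] assms(2) by simp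
    with elim(1) show ?case by simp
  qed
qed

text \<open>For nonnegative \<open>X\<close> the Laplace transform decreases to \<open>P (X = 0)\<close> at infinity.\<close>

lemma (in prob_space) AE_pos_if_laplace_vanishes:
  fixes X :: "'a \<Rightarrow> real"
  assumes [measurable]: "X \<in> borel_measurable M" and nn: "AE \<omega> in M. 0 \<le> X \<omega>"
    and lim: "(\<lambda>n. \<integral>\<omega>. exp (- real n * X \<omega>) \<partial>M) \<longlonglongrightarrow> 0"
  shows "AE \<omega> in M. 0 < X \<omega>"
proof -
  have le: "prob {\<omega> \<in> space M. X \<omega> \<le> 0} \<le> (\<integral>\<omega>. exp (- real n * X \<omega>) \<partial>M)" for n
  proof -
    have "prob {\<omega> \<in> space M. X \<omega> \<le> 0} = (\<integral>\<omega>. indicator {\<omega> \<in> space M. X \<omega> \<le> 0} \<omega> \<partial>M)"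
      by simp
    also have "\<dots> \<le> (\<integral>\<omega>. exp (- real n * X \<omega>) \<partial>M)"
    proof (rule integral_mono_AE)
      show "integrable M (\<lambda>\<omega>. exp (- real n * X \<omega>))"
        using nn by (intro integrable_const_bound[where B=1]) (auto elim!: eventually_mono)
      show "AE \<omega> in M. indicator {\<omega> \<in> space M. X \<omega> \<le> 0} \<omega> \<le> exp (- real n * X \<omega>)"
        using nn by eventually_elim (auto simp: indicator_def)
    qed (auto simp: emeasure_eq_measure)
    finally show ?thesis .
  qed
  have "prob {\<omega> \<in> space M. X \<omega> \<le> 0} \<le> 0"
    by (rule LIMSEQ_le_const[OF lim]) (use le in auto)
  then have "prob {\<omega> \<in> space M. X \<omega> \<le> 0} = 0" using measure_nonneg[of M] by (auto intro: antisym)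
  then have "AE \<omega> in M. \<not> X \<omega> \<le> 0"
    by (subst (asm) prob_eq_0) auto
  then show ?thesis by eventually_elim simp
qed

text \<open>Self-similarity of a stable subordinator at a fixed time. Both sides have the same Laplace transform,
hence by \<open>char_of_stable_laplace\<close> the same characteristic function, and the uniqueness theorem of Levy applies.\<close>

lemma (in prob_space) stable_scaling:
  fixes X Y :: "'a \<Rightarrow> real"
  assumes [measurable]: "X \<in> borel_measurable M" "Y \<in> borel_measurable M"
    and nn: "AE \<omega> in M. 0 \<le> X \<omega>" "AE \<omega> in M. 0 \<le> Y \<omega>"
    and b: "0 < b" and s: "0 < s"
    and X: "\<And>\<xi>. 0 < \<xi> \<Longrightarrow> (\<integral>\<omega>. exp (- \<xi> * X \<omega>) \<partial>M) = exp (- s * \<xi> powr b)"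
    and Y: "\<And>\<xi>. 0 < \<xi> \<Longrightarrow> (\<integral>\<omega>. exp (- \<xi> * Y \<omega>) \<partial>M) = exp (- (\<xi> powr b))"
  shows "distr M borel X = distr M borel (\<lambda>\<omega>. s powr (1 / b) * Y \<omega>)"
proof (rule Levy_uniqueness)
  let ?Z = "\<lambda>\<omega>. s powr (1 / b) * Y \<omega>"
  have nnZ: "AE \<omega> in M. 0 \<le> ?Z \<omega>" using nn(2) by eventually_elim simp
  have Z: "(\<integral>\<omega>. exp (- \<xi> * ?Z \<omega>) \<partial>M) = exp (- s * \<xi> powr b)" if "0 < \<xi>" for \<xi>
  proof -
    have "(\<integral>\<omega>. exp (- \<xi> * ?Z \<omega>) \<partial>M) = (\<integral>\<omega>. exp (- (\<xi> * s powr (1 / b)) * Y \<omega>) \<partial>M)"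
      by (simp add: mult.assoc)
    also have "\<dots> = exp (- ((\<xi> * s powr (1 / b)) powr b))"
      using that s by (intro Y) auto
    also have "(\<xi> * s powr (1 / b)) powr b = s * \<xi> powr b"
      using that s b by (simp add: powr_mult powr_powr)
    finally show ?thesis by simp
  qed
  show "char (distr M borel X) = char (distr M borel ?Z)"
  proof
    fix \<xi>
    have "char (distr M borel V) \<xi> = (\<integral>\<omega>. iexp (\<xi> * V \<omega>) \<partial>M)"
      if "V \<in> borel_measurable M" for V
      using that by (simp add: char_def integral_distr)
    from this[of X] this[of ?Z] show "char (distr M borel X) \<xi> = char (distr M borel ?Z) \<xi>"
      using char_of_stable_laplace[OF _ nn(1) b X] char_of_stable_laplace[OF _ nnZ b Z] by simp
  qed
qed (auto intro!: real_distribution_distr)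

lemma Gamma_moment_identity:
  assumes b: "0 < (b::real)" and k: "0 < k"
  shows "Gamma (real k) / (b * Gamma (b * real k)) = fact k / Gamma (b * real k + 1)"
proof -
  obtain m where m: "k = Suc m" using k by (cases k) auto
  have "Gamma (real k) = fact m" using Gamma_fact[of m, where 'a=real] by (simp add: m add.commute)
  moreover have "Gamma (b * real k + 1) = (b * real k) * Gamma (b * real k)"
  proof (rule Gamma_plus1)
    show "b * real k \<notin> \<int>\<^sub>\<le>\<^sub>0" using nonpos_Ints_nonpos[of "b * real k"] b k by (auto simp: mult_le_0_iff)
  qed
  moreover have "fact k = real k * (fact m :: real)" by (simp add: m)
  ultimately show ?thesis using b k by simp
qed

text \<open>Almost surely \<open>K\<close> is positive and nondecreasing on the positive times and unbounded, so that the exit from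
the open interval can only happen by reaching \<open>t\<close>: the events \<open>L t \<le> x\<close> and \<open>t \<le> K x\<close> agree up to the
event \<open>L t = x\<close>, which is null because \<open>L t\<close> has a density. By self-similarity \<open>K x\<close> has the law of
\<open>x powr (1 / b) * K 1\<close>, and therefore \<open>L t\<close> has the law of \<open>Y = (t / K 1) powr b\<close>. The moments of \<open>Y\<close> are negative
moments of \<open>K 1\<close>.\<close>

lemma (in prob_space) inverse_process_mittag_leffler:
  fixes K :: "real \<Rightarrow> 'a \<Rightarrow> real" and l :: "real \<Rightarrow> ennreal" and t b :: real and z :: complex
  assumes b: "0 < b" and K: "stable_subordinator M b K" and t: "0 < t"
    and dens: "distributed M lborel (inverse_process K t) l"
  shows "(\<integral>\<omega>. exp (z * of_real (inverse_process K t \<omega>)) \<partial>M) = mittag_leffler b (z * of_real (t powr b))"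
    and "AE \<omega> in M. 0 < inverse_process K t \<omega>"
proof -
  let ?L = "inverse_process K t"
  have [measurable]: "K s \<in> borel_measurable M" if "0 \<le> s" for s
    using K that by (auto simp: stable_subordinator_def levy_process_def)
  note [measurable] = this[of 1, simplified] this[of "real n" for n, simplified]
  have [measurable]: "?L \<in> borel_measurable M"
    using distributed_measurable[OF dens] by simp
  have K0: "AE \<omega> in M. K 0 \<omega> = 0"
    and mono: "AE \<omega> in M. mono_on {0..} (\<lambda>t. K t \<omega>)"
    and lap: "\<And>s \<xi>. 0 \<le> s \<Longrightarrow> 0 \<le> \<xi> \<Longrightarrow> (\<integral>\<omega>. exp (- \<xi> * K s \<omega>) \<partial>M) = exp (- s * \<xi> powr b)"
    using K by (auto simp: stable_subordinator_def levy_process_def)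
  have nn: "AE \<omega> in M. 0 \<le> K s \<omega>" if "0 \<le> s" for s
    using K that by (rule stable_subordinator_nonneg)
  have pos: "AE \<omega> in M. 0 < K s \<omega>" if s: "0 < s" for s
  proof (rule AE_pos_if_laplace_vanishes)
    have "(\<lambda>n. exp (- s * real n powr b)) \<longlonglongrightarrow> 0"
      using s b by real_asymp
    then show "(\<lambda>n. \<integral>\<omega>. exp (- real n * K s \<omega>) \<partial>M) \<longlonglongrightarrow> 0"
      using s lap[of s "real n" for n] by simp
  qed (use s nn in auto)
  \<comment> \<open>Monotonicity upgrades positivity at the times \<open>1 / Suc n\<close> to positivity at all times at once.\<close>
  have pos': "AE \<omega> in M. \<forall>s>0. 0 < K s \<omega>"
  proof -
    have "AE \<omega> in M. \<forall>n. 0 < K (inverse (real (Suc n))) \<omega>"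
      by (intro AE_all_countable[THEN iffD2] allI pos) simp
    with mono show ?thesis
    proof eventually_elim
      case (elim \<omega>)
      show ?case
      proof (intro allI impI)
        fix s :: real assume "0 < s"
        then obtain n where "inverse (real (Suc n)) < s" using reals_Archimedean by blast
        then have "K (inverse (real (Suc n))) \<omega> \<le> K s \<omega>"
          using mono_onD[OF elim(1), of "inverse (real (Suc n))" s] \<open>0 < s\<close> by simp
        with elim(2) show "0 < K s \<omega>" using less_le_trans by blast
      qed
    qed
  qed
  have unbounded: "AE \<omega> in M. \<exists>n. t \<le> K (real n) \<omega>"
  proof -
    have int: "integrable M (\<lambda>\<omega>. exp (t - K (real n) \<omega>))" for n
      using nn[of "real n"]
      by (intro integrable_const_bound[where B="exp t"]) (auto elim!: eventually_mono)
    \<comment> \<open>Markov's inequality for \<open>exp (t - K n)\<close>, which exceeds \<open>1\<close> on the event.\<close>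
    have le: "prob {\<omega> \<in> space M. \<forall>n. K (real n) \<omega> < t} \<le> exp t * exp (- real n)" for n
    proof -
      have "prob {\<omega> \<in> space M. \<forall>n. K (real n) \<omega> < t} = (\<integral>\<omega>. indicator {\<omega> \<in> space M. \<forall>n. K (real n) \<omega> < t} \<omega> \<partial>M)"
        by simp
      also have "\<dots> \<le> (\<integral>\<omega>. exp (t - K (real n) \<omega>) \<partial>M)"
      proof (rule integral_mono)
        show "indicator {\<omega> \<in> space M. \<forall>n. K (real n) \<omega> < t} \<omega> \<le> exp (t - K (real n) \<omega>)" for \<omega>
          by (auto simp: indicator_def less_imp_le)
      qed (auto simp: emeasure_eq_measure int)
      also have "\<dots> = exp t * (\<integral>\<omega>. exp (- 1 * K (real n) \<omega>) \<partial>M)"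
        by (simp add: exp_diff exp_minus divide_inverse)
      also have "(\<integral>\<omega>. exp (- 1 * K (real n) \<omega>) \<partial>M) = exp (- real n)"
        using lap[of "real n" 1] by simp
      finally show ?thesis .
    qed
    have "(\<lambda>n. exp t * exp (- real n)) \<longlonglongrightarrow> 0" by real_asymp
    then have "prob {\<omega> \<in> space M. \<forall>n. K (real n) \<omega> < t} \<le> 0"
      by (rule LIMSEQ_le_const) (use le in auto)
    then have "prob {\<omega> \<in> space M. \<forall>n. K (real n) \<omega> < t} = 0"
      using measure_nonneg[of M] by (auto intro: antisym)
    then have "AE \<omega> in M. \<not> (\<forall>n. K (real n) \<omega> < t)" by (subst (asm) prob_eq_0) auto
    then show ?thesis by eventually_elim (auto simp: not_less)
  qed
  define E where "E \<omega> = {s. 0 < s \<and> K s \<omega> \<notin> {0<..<t}}" for \<omega>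
  have L_eq: "?L \<omega> = Inf (E \<omega>)" for \<omega> by (simp add: inverse_process_def E_def)
  have bdd: "bdd_below (E \<omega>)" for \<omega> by (rule bdd_belowI[of _ 0]) (auto simp: E_def)
  \<comment> \<open>The infimum of the empty set is an unspecified real; it has to be excluded.\<close>
  have ne: "AE \<omega> in M. E \<omega> \<noteq> {}"
    using unbounded K0
  proof eventually_elim
    case (elim \<omega>)
    then obtain n where n: "t \<le> K (real n) \<omega>" by auto
    with elim(2) t have "0 < real n" by (cases n) auto
    with n have "real n \<in> E \<omega>" by (auto simp: E_def)
    then show ?case by auto
  qed
  have no_atom: "AE \<omega> in M. ?L \<omega> \<noteq> x" for x
  proof -
    have "AE y in density lborel l. y \<noteq> x"
      using AE_lborel_singleton[of x] distributed_borel_measurable[OF dens]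
      by (subst AE_density) (auto elim!: eventually_mono)
    then have "AE y in distr M lborel ?L. y \<noteq> x"
      by (simp only: distributed_distr_eq_density[OF dens])
    then show ?thesis by (subst (asm) AE_distr_iff) auto
  qed
  show L_pos: "AE \<omega> in M. 0 < ?L \<omega>"
    using ne no_atom[of 0]
  proof eventually_elim
    case (elim \<omega>)
    have "0 \<le> ?L \<omega>" unfolding L_eq by (intro cInf_greatest elim) (auto simp: E_def)
    with elim(2) show ?case by simp
  qed
  have L_le: "AE \<omega> in M. ?L \<omega> \<le> x \<longleftrightarrow> t \<le> K x \<omega>" if x: "0 < x" for x
    using ne no_atom[of x] pos' mono
  proof eventually_elim
    case (elim \<omega>)
    show ?case
    proof
      assume "?L \<omega> \<le> x"
      with elim(2) have "Inf (E \<omega>) < x" by (simp add: L_eq)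
      then obtain u where u: "u \<in> E \<omega>" "u < x" using cInf_lessD[OF elim(1)] by blast
      then have "t \<le> K u \<omega>" using elim(3) by (auto simp: E_def)
      also have "\<dots> \<le> K x \<omega>" using mono_onD[OF elim(4), of u x] u x by (simp add: E_def)
      finally show "t \<le> K x \<omega>" .
    next
      assume "t \<le> K x \<omega>"
      then have "x \<in> E \<omega>" using x by (auto simp: E_def)
      then show "?L \<omega> \<le> x" unfolding L_eq by (rule cInf_lower[OF _ bdd])
    qed
  qed
  define Y where "Y \<omega> = (t / K 1 \<omega>) powr b" for \<omega>
  have [measurable]: "Y \<in> borel_measurable M" unfolding Y_def by measurable
  have lap1: "(\<integral>\<omega>. exp (- \<xi> * K 1 \<omega>) \<partial>M) = exp (- (\<xi> powr b))" if "0 < \<xi>" for \<xi>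
    using lap[of 1 \<xi>] that by simp
  have law: "distr M borel ?L = distr M borel Y"
  proof (rule cdf_unique)
    show "cdf (distr M borel ?L) = cdf (distr M borel Y)"
    proof
      fix x
      have cdf: "cdf (distr M borel Z) x = prob {\<omega> \<in> space M. Z \<omega> \<le> x}"
        if [measurable]: "Z \<in> borel_measurable M" for Z
        by (simp add: cdf_def measure_distr vimage_def Int_def conj_commute)
      have "prob {\<omega> \<in> space M. ?L \<omega> \<le> x} = prob {\<omega> \<in> space M. Y \<omega> \<le> x}"
      proof (cases "0 < x")
        case False
        have "AE \<omega> in M. ?L \<omega> \<le> x \<longleftrightarrow> Y \<omega> \<le> x"
          using L_pos pos[of 1, simplified]
        proof eventually_elim
          case (elim \<omega>)
          then have "0 < Y \<omega>" using t by (simp add: Y_def)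
          with elim False show ?case by auto
        qed
        then show ?thesis by (intro prob_eq_AE) auto
      next
        case True
        note [measurable] = \<open>\<And>s. 0 \<le> s \<Longrightarrow> K s \<in> borel_measurable M\<close>[OF less_imp_le[OF True]]
        have "prob {\<omega> \<in> space M. ?L \<omega> \<le> x} = prob {\<omega> \<in> space M. t \<le> K x \<omega>}"
          using L_le[OF True] by (intro prob_eq_AE) auto
        also have "\<dots> = measure (distr M borel (K x)) {t..}"
          by (simp add: measure_distr vimage_def Int_def conj_commute)
        also have "distr M borel (K x) = distr M borel (\<lambda>\<omega>. x powr (1 / b) * K 1 \<omega>)"
          by (rule stable_scaling[where b=b]) (use True b nn[of x] nn[of 1] lap[of x] lap1 in auto)
        also have "measure \<dots> {t..} = prob {\<omega> \<in> space M. t \<le> x powr (1 / b) * K 1 \<omega>}"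
          by (simp add: measure_distr vimage_def Int_def conj_commute)
        also have "\<dots> = prob {\<omega> \<in> space M. Y \<omega> \<le> x}"
        proof (intro prob_eq_AE)
          show "AE \<omega> in M. t \<le> x powr (1 / b) * K 1 \<omega> \<longleftrightarrow> Y \<omega> \<le> x"
            using pos[of 1, simplified]
          proof eventually_elim
            case (elim \<omega>)
            have "Y \<omega> \<le> x \<longleftrightarrow> (t / K 1 \<omega>) powr b \<le> (x powr (1 / b)) powr b"
              using True b by (simp add: Y_def powr_powr)
            also have "\<dots> \<longleftrightarrow> t / K 1 \<omega> \<le> x powr (1 / b)"
            proof -
              have "0 < t / K 1 \<omega>" using t elim by simp
              then show ?thesis
                using powr_mono2[of b "t / K 1 \<omega>" "x powr (1 / b)"]
                  powr_less_mono2[of b "x powr (1 / b)" "t / K 1 \<omega>"] b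
                by (meson less_imp_le not_less powr_ge_zero)
            qed
            also have "\<dots> \<longleftrightarrow> t \<le> x powr (1 / b) * K 1 \<omega>" using elim by (simp add: field_simps)
            finally show ?case by simp
          qed
        qed auto
        finally show ?thesis .
      qed
      then show "cdf (distr M borel ?L) x = cdf (distr M borel Y) x" by (simp add: cdf)
    qed
  qed (auto intro!: real_distribution_distr)
  have moments: "(\<integral>\<^sup>+\<omega>. ennreal (Y \<omega> ^ k) \<partial>M) = ennreal (fact k * (t powr b) ^ k / Gamma (b * real k + 1))" for k
  proof (cases "k = 0")
    case True
    then show ?thesis by (simp add: emeasure_space_1)
  next
    case False
    have "(\<integral>\<^sup>+\<omega>. ennreal (Y \<omega> ^ k) \<partial>M) = (\<integral>\<^sup>+\<omega>. ennreal ((t powr b) ^ k) * ennreal (K 1 \<omega> powr (- (b * real k))) \<partial>M)"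
    proof (rule nn_integral_cong_AE)
      show "AE \<omega> in M. ennreal (Y \<omega> ^ k) = ennreal ((t powr b) ^ k) * ennreal (K 1 \<omega> powr (- (b * real k)))"
        using pos[of 1, simplified]
      proof eventually_elim
        case (elim \<omega>)
        have "Y \<omega> ^ k = (t powr b) ^ k * K 1 \<omega> powr (- (b * real k))"
          using elim t by (simp add: Y_def powr_divide power_divide powr_minus_divide powr_powr flip: powr_realpow)
        then show ?case by (simp add: ennreal_mult)
      qed
    qed
    also have "\<dots> = ennreal ((t powr b) ^ k) * ennreal (Gamma (b * real k / b) / (b * Gamma (b * real k)))"
    proof (subst nn_integral_cmult)
      have "(\<integral>\<^sup>+\<omega>. ennreal (K 1 \<omega> powr (- (b * real k))) \<partial>M)
        = ennreal (Gamma (b * real k / b) / (b * Gamma (b * real k)))"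
        by (rule stable_negative_moment[OF _ pos b _ lap1]) (use False b in auto)
      then show "ennreal ((t powr b) ^ k) * (\<integral>\<^sup>+\<omega>. ennreal (K 1 \<omega> powr (- (b * real k))) \<partial>M)
        = ennreal ((t powr b) ^ k) * ennreal (Gamma (b * real k / b) / (b * Gamma (b * real k)))" by simp
    qed simp
    also have "Gamma (b * real k / b) / (b * Gamma (b * real k)) = fact k / Gamma (b * real k + 1)"
      using Gamma_moment_identity[of b k] False b by simp
    finally show ?thesis using t by (simp add: ennreal_mult'[symmetric] mult.commute)
  qed
  have "(\<integral>\<omega>. exp (z * of_real (?L \<omega>)) \<partial>M) = (\<integral>y. exp (z * of_real y) \<partial>distr M borel ?L)"
    by (subst integral_distr) auto
  also have "\<dots> = (\<integral>\<omega>. exp (z * of_real (Y \<omega>)) \<partial>M)"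
    unfolding law by (subst integral_distr) auto
  also have "\<dots> = mittag_leffler b (z * of_real (t powr b))"
    by (rule expectation_exp_mittag_leffler[OF _ _ _ b moments]) (auto simp: Y_def)
  finally show "(\<integral>\<omega>. exp (z * of_real (?L \<omega>)) \<partial>M) = mittag_leffler b (z * of_real (t powr b))" .
qed

section \<open>Independent random times\<close>

text \<open>A version of \<open>X\<close> that is jointly measurable in time and \<open>\<omega>\<close>: evaluate along the grid of mesh \<open>1 / Suc m\<close>, at the
grid point strictly to the right of \<open>z\<close>. Each approximation takes only countably many time values.\<close>

definition right_limit_version :: "(real \<Rightarrow> 'w \<Rightarrow> 'b::euclidean_space) \<Rightarrow> real \<Rightarrow> 'w \<Rightarrow> 'b" where
  "right_limit_version X z \<omega> =
     lim (\<lambda>m. X ((real (nat \<lfloor>real (Suc m) * z\<rfloor>) + 1) / real (Suc m)) \<omega>)"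

lemma right_limit_version_eq:
  assumes "cadlag (\<lambda>t. X t \<omega>)" and z: "0 \<le> z"
  shows "right_limit_version X z \<omega> = X z \<omega>"
  unfolding right_limit_version_def
proof (rule limI)
  define u where "u m = (real (nat \<lfloor>real (Suc m) * z\<rfloor>) + 1) / real (Suc m)" for m
  have floor: "real (nat \<lfloor>real (Suc m) * z\<rfloor>) = of_int \<lfloor>real (Suc m) * z\<rfloor>" for m
    using z by simp
  have gt: "z < u m" for m
  proof -
    have "real (Suc m) * z < of_int \<lfloor>real (Suc m) * z\<rfloor> + 1" by linarith
    then show ?thesis unfolding u_def floor by (simp add: field_simps)
  qed
  have le: "u m \<le> z + inverse (real (Suc m))" for m
  proof -
    have "of_int \<lfloor>real (Suc m) * z\<rfloor> \<le> real (Suc m) * z" by linarith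
    then have "u m \<le> (real (Suc m) * z + 1) / real (Suc m)"
      unfolding u_def floor by (intro divide_right_mono) auto
    also have "\<dots> = z + inverse (real (Suc m))" by (simp add: field_simps)
    finally show ?thesis .
  qed
  have "u \<longlonglongrightarrow> z"
  proof (rule tendsto_sandwich[where f="\<lambda>_. z" and h="\<lambda>m. z + inverse (real (Suc m))"])
    show "(\<lambda>m. z + inverse (real (Suc m))) \<longlonglongrightarrow> z"
      using tendsto_add[OF tendsto_const LIMSEQ_inverse_real_of_nat, of z] by simp
  qed (use gt le in \<open>auto simp: less_imp_le\<close>)
  then have "filterlim u (at_right z) sequentially"
    using gt by (intro filterlim_at_withinI) (auto simp: less_imp_neq[symmetric])
  moreover have "((\<lambda>t. X t \<omega>) \<longlongrightarrow> X z \<omega>) (at_right z)"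
    using assms by (simp add: cadlag_def)
  ultimately show "(\<lambda>m. X (u m) \<omega>) \<longlonglongrightarrow> X z \<omega>"
    by (rule filterlim_compose[rotated])
qed

lemma measurable_right_limit_version:
  assumes X: "\<And>t. 0 \<le> t \<Longrightarrow> X t \<in> borel_measurable N"
  shows "(\<lambda>p. right_limit_version X (fst p) (snd p)) \<in> borel_measurable (borel \<Otimes>\<^sub>M N)"
  unfolding right_limit_version_def
proof (rule borel_measurable_lim_metric)
  fix m
  show "(\<lambda>p. X ((real (nat \<lfloor>real (Suc m) * fst p\<rfloor>) + 1) / real (Suc m)) (snd p)) \<in> borel_measurable (borel \<Otimes>\<^sub>M N)"
  proof (rule measurable_compose_countable[where f="\<lambda>j p. X ((real j + 1) / real (Suc m)) (snd p)" and g="\<lambda>p. nat \<lfloor>real (Suc m) * fst p\<rfloor>"])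
    fix j :: nat
    have [measurable]: "X ((real j + 1) / real (Suc m)) \<in> borel_measurable N" by (rule X) simp
    show "(\<lambda>p. X ((real j + 1) / real (Suc m)) (snd p)) \<in> borel_measurable (borel \<Otimes>\<^sub>M N)"
      by measurable
  qed measurable
qed

lemma sets_sigma_process_events:
  "sets (sigma (space M) {X t -` A \<inter> space M | t A. 0 \<le> t \<and> A \<in> sets borel}) = process_events M X"
  unfolding process_events_def by (rule sets_measure_of) auto

lemma Int_stable_process_events: "Int_stable (process_events M X)"
  unfolding sets_sigma_process_events[symmetric] by (rule sets.Int_stable)

lemma process_events_subset_Pow: "process_events M X \<subseteq> Pow (space M)"
proof
  fix A assume "A \<in> process_events M X"
  then have "A \<subseteq> space M"
    unfolding process_events_def by (rule sigma_sets_into_sp[rotated]) auto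
  then show "A \<in> Pow (space M)" by simp
qed

lemma process_events_preimage:
  "0 \<le> t \<Longrightarrow> A \<in> sets borel \<Longrightarrow> X t -` A \<inter> space M \<in> process_events M X"
  unfolding process_events_def by (intro sigma_sets.Basic) auto

text \<open>Stated with families of events because \<open>indep_var\<close> forces both random elements to have the same value type.\<close>

lemma (in prob_space) indep_set_product_law:
  assumes ind: "indep_set P Q"
    and X: "X \<in> M \<rightarrow>\<^sub>M A" "\<And>a. a \<in> sets A \<Longrightarrow> X -` a \<inter> space M \<in> P"
    and Y: "Y \<in> M \<rightarrow>\<^sub>M B" "\<And>b. b \<in> sets B \<Longrightarrow> Y -` b \<inter> space M \<in> Q"
  shows "distr M (A \<Otimes>\<^sub>M B) (\<lambda>\<omega>. (X \<omega>, Y \<omega>)) = distr M A X \<Otimes>\<^sub>M distr M B Y"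
proof -
  interpret X: prob_space "distr M A X" by (rule prob_space_distr[OF X(1)])
  interpret Y: prob_space "distr M B Y" by (rule prob_space_distr[OF Y(1)])
  have [measurable]: "(\<lambda>\<omega>. (X \<omega>, Y \<omega>)) \<in> M \<rightarrow>\<^sub>M A \<Otimes>\<^sub>M B" using X(1) Y(1) by simp
  show ?thesis
  proof (rule pair_measure_eqI[symmetric])
    show "sigma_finite_measure (distr M A X)" "sigma_finite_measure (distr M B Y)" ..
    show "sets (distr M A X \<Otimes>\<^sub>M distr M B Y) = sets (distr M (A \<Otimes>\<^sub>M B) (\<lambda>\<omega>. (X \<omega>, Y \<omega>)))"
      by (simp cong: sets_pair_measure_cong)
    fix a b assume "a \<in> sets (distr M A X)" "b \<in> sets (distr M B Y)"
    then have ab: "a \<in> sets A" "b \<in> sets B" by auto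
    have "(\<lambda>\<omega>. (X \<omega>, Y \<omega>)) -` (a \<times> b) \<inter> space M = (X -` a \<inter> space M) \<inter> (Y -` b \<inter> space M)" by auto
    then show "emeasure (distr M A X) a * emeasure (distr M B Y) b
        = emeasure (distr M (A \<Otimes>\<^sub>M B) (\<lambda>\<omega>. (X \<omega>, Y \<omega>))) (a \<times> b)"
      using ab indep_setD[OF ind X(2)[OF ab(1)] Y(2)[OF ab(2)]]
      by (simp add: emeasure_distr X(1) Y(1) emeasure_eq_measure ennreal_mult)
  qed
qed

lemma (in prob_space) product_law_integrals:
  assumes X: "X \<in> M \<rightarrow>\<^sub>M A" and Y: "Y \<in> M \<rightarrow>\<^sub>M B"
    and law: "distr M (A \<Otimes>\<^sub>M B) (\<lambda>\<omega>. (X \<omega>, Y \<omega>)) = distr M A X \<Otimes>\<^sub>M distr M B Y"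
  shows product_law_nn_integral: "f \<in> borel_measurable (A \<Otimes>\<^sub>M B) \<Longrightarrow>
      (\<integral>\<^sup>+\<omega>. f (X \<omega>, Y \<omega>) \<partial>M) = (\<integral>\<^sup>+x. (\<integral>\<^sup>+\<omega>. f (x, Y \<omega>) \<partial>M) \<partial>distr M A X)"
    and product_law_integral: "\<And>g :: _ \<Rightarrow> complex. g \<in> borel_measurable (A \<Otimes>\<^sub>M B) \<Longrightarrow> (\<And>p. norm (g p) \<le> c) \<Longrightarrow>
      (\<integral>\<omega>. g (X \<omega>, Y \<omega>) \<partial>M) = (\<integral>x. (\<integral>\<omega>. g (x, Y \<omega>) \<partial>M) \<partial>distr M A X)"
proof -
  note [measurable] = X Y
  interpret X: prob_space "distr M A X" by (rule prob_space_distr[OF X])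
  interpret Y: prob_space "distr M B Y" by (rule prob_space_distr[OF Y])
  interpret XY: pair_prob_space "distr M A X" "distr M B Y" ..
  have pair: "(\<lambda>\<omega>. (X \<omega>, Y \<omega>)) \<in> M \<rightarrow>\<^sub>M A \<Otimes>\<^sub>M B" by simp
  have sets: "sets (distr M A X \<Otimes>\<^sub>M distr M B Y) = sets (A \<Otimes>\<^sub>M B)"
    by (simp cong: sets_pair_measure_cong)
  show "(\<integral>\<^sup>+\<omega>. f (X \<omega>, Y \<omega>) \<partial>M) = (\<integral>\<^sup>+x. (\<integral>\<^sup>+\<omega>. f (x, Y \<omega>) \<partial>M) \<partial>distr M A X)"
    if [measurable]: "f \<in> borel_measurable (A \<Otimes>\<^sub>M B)"
  proof -
    have "(\<integral>\<^sup>+\<omega>. f (X \<omega>, Y \<omega>) \<partial>M) = (\<integral>\<^sup>+p. f p \<partial>(distr M A X \<Otimes>\<^sub>M distr M B Y))"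
      unfolding law[symmetric] by (subst nn_integral_distr[OF pair]) auto
    also have "\<dots> = (\<integral>\<^sup>+x. (\<integral>\<^sup>+y. f (x, y) \<partial>distr M B Y) \<partial>distr M A X)"
      by (rule Y.nn_integral_fst[symmetric]) (simp add: measurable_cong_sets[OF sets refl])
    also have "\<dots> = (\<integral>\<^sup>+x. (\<integral>\<^sup>+\<omega>. f (x, Y \<omega>) \<partial>M) \<partial>distr M A X)"
      by (intro nn_integral_cong) (simp add: nn_integral_distr)
    finally show ?thesis .
  qed
  show "(\<integral>\<omega>. g (X \<omega>, Y \<omega>) \<partial>M) = (\<integral>x. (\<integral>\<omega>. g (x, Y \<omega>) \<partial>M) \<partial>distr M A X)"
    if [measurable]: "g \<in> borel_measurable (A \<Otimes>\<^sub>M B)" and bound: "\<And>p. norm (g p) \<le> c" for g :: "_ \<Rightarrow> complex"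
  proof -
    have "(\<integral>\<omega>. g (X \<omega>, Y \<omega>) \<partial>M) = (\<integral>p. g p \<partial>(distr M A X \<Otimes>\<^sub>M distr M B Y))"
      unfolding law[symmetric] by (subst integral_distr[OF pair]) auto
    also have "\<dots> = (\<integral>x. (\<integral>y. g (x, y) \<partial>distr M B Y) \<partial>distr M A X)"
      by (rule XY.integral_fst'[symmetric], rule XY.P.integrable_const_bound[where B=c])
         (simp_all add: measurable_cong_sets[OF sets refl] bound)
    also have "\<dots> = (\<integral>x. (\<integral>\<omega>. g (x, Y \<omega>) \<partial>M) \<partial>distr M A X)"
      by (intro Bochner_Integration.integral_cong) (simp_all add: integral_distr)
    finally show ?thesis .
  qed
qed

text \<open>Here the second random element is the identity, with values in the sample space carrying the
sigma-algebra generated by \<open>S\<close> and \<open>H\<close>. Independence of the random time from the pair of processes thus becomes a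
product law, and Fubini's theorem freezes the time in any functional of the time and the two paths.\<close>

lemma (in prob_space) independent_time_product_law:
  fixes L :: "real \<Rightarrow> 'a \<Rightarrow> real"
  assumes ind: "independent_processes M S H L" and t: "0 \<le> t"
  defines "N \<equiv> sigma (space M) (process_events M S \<union> process_events M H)"
  shows "(\<lambda>\<omega>. \<omega>) \<in> M \<rightarrow>\<^sub>M N"
    and "L t \<in> borel_measurable M"
    and "distr M (borel \<Otimes>\<^sub>M N) (\<lambda>\<omega>. (L t \<omega>, \<omega>)) = distr M borel (L t) \<Otimes>\<^sub>M distr M N (\<lambda>\<omega>. \<omega>)"
proof -
  let ?F = "\<lambda>i. [process_events M S, process_events M H, process_events M L] ! i"
  let ?I = "\<lambda>j. if j then {2} else {0, 1::nat}"
  have ind3: "indep_sets ?F {..<3}" using ind by (simp add: independent_processes_def)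
  have "(\<Union>j\<in>UNIV. ?I j) \<subseteq> {..<3}" by auto
  then have "indep_sets ?F (\<Union>j\<in>UNIV. ?I j)" by (rule indep_sets_mono_index[OF _ ind3])
  then have "indep_sets (\<lambda>j. sigma_sets (space M) (\<Union>i\<in>?I j. ?F i)) UNIV"
  proof (rule indep_sets_collect_sigma)
    fix i j assume "i \<in> ?I j"
    then have "i = 0 \<or> i = 1 \<or> i = 2" by (auto split: if_splits)
    then show "Int_stable (?F i)" by (auto simp: Int_stable_process_events)
  qed (auto simp: disjoint_family_on_def)
  then have ind2: "indep_set (sigma_sets (space M) (process_events M L))
      (sigma_sets (space M) (process_events M S \<union> process_events M H))"
    unfolding indep_set_def
  proof (rule indep_sets_mono_sets)
    fix j :: bool
    show "case_bool (sigma_sets (space M) (process_events M L))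
        (sigma_sets (space M) (process_events M S \<union> process_events M H)) j
      \<subseteq> sigma_sets (space M) (\<Union>i\<in>?I j. ?F i)"
      by (cases j) simp_all
  qed
  have N: "sets N = sigma_sets (space M) (process_events M S \<union> process_events M H)" "space N = space M"
    using process_events_subset_Pow[of M S] process_events_subset_Pow[of M H]
    unfolding N_def by (auto intro: sets_measure_of space_measure_of)
  have N_id: "(\<lambda>\<omega>. \<omega>) -` B \<inter> space M = B" if "B \<in> sets N" for B
    using sets.sets_into_space[OF that] N(2) by auto
  have "sets N \<subseteq> events" using indep_setD_ev2[OF ind2] N by simp
  then show id: "(\<lambda>\<omega>. \<omega>) \<in> M \<rightarrow>\<^sub>M N"
    using N(2) N_id by (intro measurableI) auto
  have L_sub: "L t -` A \<inter> space M \<in> sigma_sets (space M) (process_events M L)" if "A \<in> sets borel" for A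
    using t that by (intro sigma_sets.Basic process_events_preimage)
  then show L: "L t \<in> borel_measurable M"
    using indep_setD_ev1[OF ind2] by (intro measurableI) auto
  show "distr M (borel \<Otimes>\<^sub>M N) (\<lambda>\<omega>. (L t \<omega>, \<omega>)) = distr M borel (L t) \<Otimes>\<^sub>M distr M N (\<lambda>\<omega>. \<omega>)"
  proof (rule indep_set_product_law[OF ind2])
    show "(\<lambda>\<omega>. \<omega>) -` b \<inter> space M \<in> sigma_sets (space M) (process_events M S \<union> process_events M H)"
      if "b \<in> sets N" for b
      using that N_id[OF that] N(1) by metis
    show "L t -` a \<inter> space M \<in> sigma_sets (space M) (process_events M L)" if "a \<in> sets borel" for a
      using that by (rule L_sub)
  qed (rule L id)+
qed

lemma (in prob_space) independent_processes_product_law: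
  assumes ind: "independent_processes M S H L" and t: "0 \<le> t"
    and "S t \<in> borel_measurable M" "H t \<in> borel_measurable M"
  shows "distr M (borel \<Otimes>\<^sub>M borel) (\<lambda>\<omega>. (S t \<omega>, H t \<omega>)) = distr M borel (S t) \<Otimes>\<^sub>M distr M borel (H t)"
proof -
  let ?F = "\<lambda>i. [process_events M S, process_events M H, process_events M L] ! i"
  have ind3: "indep_sets ?F {..<3}" using ind by (simp add: independent_processes_def)
  have "indep_set (process_events M S) (process_events M H)"
    unfolding indep_sets2_eq
  proof (intro conjI ballI)
    show "process_events M S \<subseteq> events" "process_events M H \<subseteq> events"
      using ind3[unfolded indep_sets_def, THEN conjunct1, rule_format, of 0]
        ind3[unfolded indep_sets_def, THEN conjunct1, rule_format, of 1] by auto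
    fix A B assume "A \<in> process_events M S" "B \<in> process_events M H"
    then show "prob (A \<inter> B) = prob A * prob B"
      using indep_setsD[OF ind3, of "{0, 1}" "\<lambda>i. if i = 0 then A else B"]
      by (auto simp: Int_commute)
  qed
  then show ?thesis
  proof (rule indep_set_product_law)
    show "S t -` a \<inter> space M \<in> process_events M S" if "a \<in> sets borel" for a
      using t that by (rule process_events_preimage)
    show "H t -` b \<inter> space M \<in> process_events M H" if "b \<in> sets borel" for b
      using t that by (rule process_events_preimage)
  qed (rule assms)+
qed

text \<open>The subordinated process is measurable only up to a null set: off the event of well-behaved
paths, its value at the random time is arbitrary.\<close>

lemma measurable_completion_AE_eq:
  assumes g: "g \<in> M \<rightarrow>\<^sub>M A" and ae: "AE x in M. f x = g x" and f: "\<And>x. f x \<in> space A"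
  shows "f \<in> completion M \<rightarrow>\<^sub>M A"
proof (rule measurableI)
  from AE_E[OF ae] obtain N where "{x \<in> space M. f x \<noteq> g x} \<subseteq> N" "emeasure M N = 0" "N \<in> sets M" .
  then have N: "{x \<in> space M. f x \<noteq> g x} \<subseteq> N" "N \<in> null_sets M" by auto
  note [measurable] = g
  fix a assume [measurable]: "a \<in> sets A"
  have "N \<in> sets M" using N(2) by auto
  have "f -` a \<inter> space M = (g -` a \<inter> space M - N) \<union> (f -` a \<inter> space M \<inter> N)"
    using N(1) by auto
  moreover have "g -` a \<inter> space M - N \<in> sets M" using \<open>N \<in> sets M\<close> by simp
  ultimately have "f -` a \<inter> space M \<in> sets (completion M)"
    using N(2) by (intro sets_completionI[of _ _ "f -` a \<inter> space M \<inter> N" N]) auto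
  then show "f -` a \<inter> space (completion M) \<in> sets (completion M)" by simp
qed (use f in auto)

text \<open>Extension by \<open>0\<close> to nonpositive times, so that the densities can be integrated over all of \<open>real\<close>.\<close>

lemma process_density_borel_measurable:
  fixes f :: "'b::euclidean_space \<Rightarrow> real \<Rightarrow> ennreal"
  assumes "has_process_density M X f"
  shows "(\<lambda>p. if 0 < snd p then f (fst p) (snd p) else 0) \<in> borel_measurable (borel \<Otimes>\<^sub>M borel)"
proof -
  let ?R = "restrict_space (borel \<Otimes>\<^sub>M borel) {p :: 'b \<times> real. 0 < snd p}"
  have f: "case_prod f \<in> borel_measurable (borel \<Otimes>\<^sub>M restrict_space borel {0<..})"
    using assms by (simp add: has_process_density_def)
  have "fst \<in> ?R \<rightarrow>\<^sub>M borel" by (intro measurable_restrict_space1 measurable_fst)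
  moreover have "snd \<in> ?R \<rightarrow>\<^sub>M restrict_space borel {0<..}"
  proof (rule measurable_restrict_space2)
    show "snd \<in> ?R \<rightarrow>\<^sub>M borel" by (intro measurable_restrict_space1 measurable_snd)
  qed (auto simp: space_restrict_space)
  ultimately have pair: "(\<lambda>p. (fst p, snd p)) \<in> ?R \<rightarrow>\<^sub>M borel \<Otimes>\<^sub>M restrict_space borel {0<..}"
    by (rule measurable_Pair)
  from measurable_compose[OF pair f]
  have "(\<lambda>p. f (fst p) (snd p)) \<in> borel_measurable ?R" by (simp add: case_prod_unfold)
  moreover have "{p \<in> space (borel \<Otimes>\<^sub>M borel). 0 < snd p} = {p :: 'b \<times> real. 0 < snd p}"
    by (simp add: space_pair_measure)
  moreover have "{p \<in> space (borel \<Otimes>\<^sub>M borel). 0 < snd p} \<in> sets (borel \<Otimes>\<^sub>M borel :: ('b \<times> real) measure)"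
    by measurable
  ultimately show ?thesis
    by (subst measurable_If_restrict_space_iff) simp_all
qed

lemma measurable_sigma_process_events:
  assumes "0 \<le> t" "process_events M X \<subseteq> E" "E \<subseteq> Pow (space M)"
  shows "X t \<in> borel_measurable (sigma (space M) E)"
proof (rule measurableI)
  fix A :: "'b set" assume A: "A \<in> sets borel"
  have "X t -` A \<inter> space M \<in> E" using process_events_preimage[OF assms(1) A] assms(2) by auto
  then show "X t -` A \<inter> space (sigma (space M) E) \<in> sets (sigma (space M) E)"
    using assms(3) by auto
qed simp

lemma distributed_AE_support:
  assumes dens: "distributed M lborel X f" and ae: "AE \<omega> in M. P (X \<omega>)"
    and P: "Measurable.pred borel P"
  shows "AE x in lborel. f x \<noteq> 0 \<longrightarrow> P x"
proof -
  have "AE x in distr M lborel X. P x"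
    using ae P distributed_measurable[OF dens] by (subst AE_distr_iff) auto
  then have "AE x in density lborel f. P x"
    by (simp only: distributed_distr_eq_density[OF dens])
  then show ?thesis
    using distributed_borel_measurable[OF dens] by (subst (asm) AE_density) (auto simp: zero_less_iff_neq_zero)
qed

section \<open>The density of the subordinated process\<close>

lemma nonneg_orthant_borel: "(nonneg_orthant :: (real ^ 'n) set) \<in> sets borel"
proof -
  have "closed (nonneg_orthant :: (real ^ 'n) set)"
    unfolding nonneg_orthant_def by (intro closed_Collect_all closed_Collect_le continuous_intros)
  then show ?thesis by simp
qed

lemma measurable_curried:
  assumes "case_prod F \<in> borel_measurable (borel \<Otimes>\<^sub>M borel)" "f \<in> N \<rightarrow>\<^sub>M borel" "g \<in> N \<rightarrow>\<^sub>M borel"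
  shows "(\<lambda>y. F (f y) (g y)) \<in> borel_measurable N"
  using measurable_compose[OF measurable_Pair[OF assms(2,3)] assms(1)] by simp

lemma nn_integral_lborel_shift:
  fixes f :: "'b::euclidean_space \<Rightarrow> ennreal"
  assumes [measurable]: "f \<in> borel_measurable borel"
  shows "(\<integral>\<^sup>+x. f (x + c) \<partial>lborel) = (\<integral>\<^sup>+x. f x \<partial>lborel)"
proof -
  have "(\<integral>\<^sup>+x. f x \<partial>lborel) = (\<integral>\<^sup>+x. f x \<partial>distr lborel borel ((+) c))"
    by (simp add: lborel_distr_plus)
  also have "\<dots> = (\<integral>\<^sup>+x. f (x + c) \<partial>lborel)"
    by (subst nn_integral_distr) (auto simp: add.commute)
  finally show ?thesis by simp
qed

text \<open>Tonelli's theorem together with the translation \<open>x \<mapsto> x + r a\<close> brings the integral of \<open>w\<close> over a set \<open>A\<close> into the form in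
which the law at the fixed time \<open>z\<close> appears: the inner double integral is the probability of
\<open>S z + H z a \<in> A\<close>. The indicator of the orthant in the definition of \<open>w\<close> equals \<open>1\<close> on the ray spanned by \<open>a\<close>.\<close>

lemma w_distribution_Tonelli:
  fixes T :: "real ^ 'n \<Rightarrow> real \<Rightarrow> ennreal" and a :: "real ^ 'n"
  assumes T: "(\<lambda>p. if 0 < snd p then T (fst p) (snd p) else 0) \<in> borel_measurable (borel \<Otimes>\<^sub>M borel)"
    and h: "(\<lambda>p. if 0 < snd p then h (fst p) (snd p) else 0) \<in> borel_measurable (borel \<Otimes>\<^sub>M borel)"
    and l [measurable]: "(\<lambda>z. l z t) \<in> borel_measurable borel"
    and a: "a \<in> nonneg_orthant"
  shows borel_measurable_w_distribution: "(\<lambda>x. w_distribution T h l a x t) \<in> borel_measurable borel"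
    and nn_integral_w_distribution: "A \<in> sets borel \<Longrightarrow> (\<integral>\<^sup>+x. w_distribution T h l a x t * indicator A x \<partial>lborel)
      = (\<integral>\<^sup>+z. l z t * (indicator {0<..} z * (\<integral>\<^sup>+x. T x z * (\<integral>\<^sup>+r. h r z * (indicator {0<..} r * indicator A (x + r *\<^sub>R a)) \<partial>lborel) \<partial>lborel)) \<partial>lborel)"
proof -
  define T' where "T' x z = (if 0 < z then T x z else 0)" for x z
  define h' where "h' r z = (if 0 < z then h r z else 0)" for r z
  have Tm: "case_prod T' \<in> borel_measurable (borel \<Otimes>\<^sub>M borel)"
    using T by (simp add: T'_def[abs_def] case_prod_unfold)
  have hm: "case_prod h' \<in> borel_measurable (borel \<Otimes>\<^sub>M borel)"
    using h by (simp add: h'_def[abs_def] case_prod_unfold)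
  note [measurable (raw)] = measurable_curried[OF Tm] measurable_curried[OF hm]
  have orthant: "r *\<^sub>R a \<in> nonneg_orthant" if "0 < r" for r
    using a that by (simp add: nonneg_orthant_def)
  have w: "w_distribution T h l a x t
    = (\<integral>\<^sup>+z. (\<integral>\<^sup>+r. l z t * (T' (x - r *\<^sub>R a) z * (h' r z * indicator {0<..} r)) \<partial>lborel) \<partial>lborel)" for x
    unfolding w_distribution_def
  proof (rule nn_integral_cong)
    fix z
    show "(\<integral>\<^sup>+s\<in>nonneg_orthant. T (x - s) z * l z t \<partial>ray_distribution h a z) * indicator {0<..} z
      = (\<integral>\<^sup>+r. l z t * (T' (x - r *\<^sub>R a) z * (h' r z * indicator {0<..} r)) \<partial>lborel)"
    proof (cases "0 < z")
      case True
      have Tz [measurable]: "(\<lambda>x. T x z) \<in> borel_measurable borel"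
        using measurable_curried[OF Tm measurable_ident measurable_const[of z]] True by (simp add: T'_def)
      have hz [measurable]: "(\<lambda>r. h r z) \<in> borel_measurable borel"
        using measurable_curried[OF hm measurable_ident measurable_const[of z]] True by (simp add: h'_def)
      note [measurable] = nonneg_orthant_borel
      have "(\<integral>\<^sup>+s\<in>nonneg_orthant. T (x - s) z * l z t \<partial>ray_distribution h a z)
        = (\<integral>\<^sup>+r. T (x - r *\<^sub>R a) z * l z t * indicator nonneg_orthant (r *\<^sub>R a)
            \<partial>density lborel (\<lambda>r. h r z * indicator {0<..} r))"
        unfolding ray_distribution_def by (rule nn_integral_distr) simp_all
      also have "\<dots> = (\<integral>\<^sup>+r. h r z * indicator {0<..} r *
          (T (x - r *\<^sub>R a) z * l z t * indicator nonneg_orthant (r *\<^sub>R a)) \<partial>lborel)"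
        by (rule nn_integral_density) simp_all
      also have "\<dots> = (\<integral>\<^sup>+r. l z t * (T' (x - r *\<^sub>R a) z * (h' r z * indicator {0<..} r)) \<partial>lborel)"
        using True by (intro nn_integral_cong)
          (auto simp: T'_def h'_def indicator_def orthant mult_ac)
      finally show ?thesis using True by simp
    qed (simp add: T'_def)
  qed
  show "(\<lambda>x. w_distribution T h l a x t) \<in> borel_measurable borel"
    unfolding w by measurable
  assume [measurable]: "A \<in> sets borel"
  have "(\<integral>\<^sup>+x. w_distribution T h l a x t * indicator A x \<partial>lborel)
    = (\<integral>\<^sup>+x. (\<integral>\<^sup>+z. (\<integral>\<^sup>+r. l z t * (T' (x - r *\<^sub>R a) z * (h' r z * indicator {0<..} r)) * indicator A x \<partial>lborel) \<partial>lborel) \<partial>lborel)"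
    unfolding w by (simp add: nn_integral_multc)
  also have "\<dots> = (\<integral>\<^sup>+z. (\<integral>\<^sup>+x. (\<integral>\<^sup>+r. l z t * (T' (x - r *\<^sub>R a) z * (h' r z * indicator {0<..} r)) * indicator A x \<partial>lborel) \<partial>lborel) \<partial>lborel)"
    by (rule lborel_pair.Fubini') measurable
  also have "\<dots> = (\<integral>\<^sup>+z. (\<integral>\<^sup>+r. (\<integral>\<^sup>+x. l z t * (T' (x - r *\<^sub>R a) z * (h' r z * indicator {0<..} r)) * indicator A x \<partial>lborel) \<partial>lborel) \<partial>lborel)"
    by (rule nn_integral_cong, rule lborel_pair.Fubini') measurable
  also have "\<dots> = (\<integral>\<^sup>+z. (\<integral>\<^sup>+r. (\<integral>\<^sup>+x. l z t * (T' x z * (h' r z * indicator {0<..} r)) * indicator A (x + r *\<^sub>R a) \<partial>lborel) \<partial>lborel) \<partial>lborel)"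
  proof (rule nn_integral_cong, rule nn_integral_cong)
    fix z r :: real
    show "(\<integral>\<^sup>+x. l z t * (T' (x - r *\<^sub>R a) z * (h' r z * indicator {0<..} r)) * indicator A x \<partial>lborel)
      = (\<integral>\<^sup>+x. l z t * (T' x z * (h' r z * indicator {0<..} r)) * indicator A (x + r *\<^sub>R a) \<partial>lborel)"
      by (subst nn_integral_lborel_shift[where c="r *\<^sub>R a", symmetric]) simp_all
  qed
  also have "\<dots> = (\<integral>\<^sup>+z. (\<integral>\<^sup>+x. (\<integral>\<^sup>+r. l z t * (T' x z * (h' r z * indicator {0<..} r)) * indicator A (x + r *\<^sub>R a) \<partial>lborel) \<partial>lborel) \<partial>lborel)"
    by (rule nn_integral_cong, rule lborel_pair.Fubini') measurable
  also have "\<dots> = (\<integral>\<^sup>+z. l z t * (\<integral>\<^sup>+x. T' x z * (\<integral>\<^sup>+r. h' r z * (indicator {0<..} r * indicator A (x + r *\<^sub>R a)) \<partial>lborel) \<partial>lborel) \<partial>lborel)"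
    by (simp add: nn_integral_cmult mult.assoc)
  also have "\<dots> = (\<integral>\<^sup>+z. l z t * (indicator {0<..} z * (\<integral>\<^sup>+x. T x z * (\<integral>\<^sup>+r. h r z * (indicator {0<..} r * indicator A (x + r *\<^sub>R a)) \<partial>lborel) \<partial>lborel)) \<partial>lborel)"
    by (intro nn_integral_cong) (auto simp: T'_def h'_def indicator_def)
  finally show "(\<integral>\<^sup>+x. w_distribution T h l a x t * indicator A x \<partial>lborel)
      = (\<integral>\<^sup>+z. l z t * (indicator {0<..} z * (\<integral>\<^sup>+x. T x z * (\<integral>\<^sup>+r. h r z * (indicator {0<..} r * indicator A (x + r *\<^sub>R a)) \<partial>lborel) \<partial>lborel)) \<partial>lborel)" .
qed

section \<open>Law and characteristic function of the subordinated process\<close>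

theorem mainTheorem8:
  fixes M :: "'w measure"
    and S :: "real \<Rightarrow> 'w \<Rightarrow> real ^ 'n"
    and H K L :: "real \<Rightarrow> 'w \<Rightarrow> real"
    and W :: "real \<Rightarrow> 'w \<Rightarrow> real ^ 'n"
    and T :: "real ^ 'n \<Rightarrow> real \<Rightarrow> ennreal"
    and h l :: "real \<Rightarrow> real \<Rightarrow> ennreal"
    and a :: "real ^ 'n"
    and \<theta> \<alpha> \<beta> :: real
  assumes "prob_space M"
    and "0 < \<theta>" and "\<theta> < 1"
    and "0 < \<alpha>" and "\<alpha> < 1"
    and "0 < \<beta>" and "\<beta> < 1"
    and "a \<in> nonneg_orthant" and "norm a = 1"
    and "isotropic_stable_process M \<theta> S"
    and "stable_subordinator M \<alpha> H"
    and "stable_subordinator M \<beta> K"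
    and "L = inverse_process K"
    and "independent_processes M S H L"
    and "has_process_density M S T"
    and "has_process_density M H h"
    and "\<And>t. 0 < t \<Longrightarrow> distributed M lborel (L t) (\<lambda>z. l z t)"
    and "W = (\<lambda>t \<omega>. S (L t \<omega>) \<omega> + H (L t \<omega>) \<omega> *\<^sub>R a)"
  shows "\<forall>t>0.
           distributed (completion M) lborel (W t) (\<lambda>x. w_distribution T h l a x t) \<and>
           (\<forall>\<xi>. (\<integral>\<omega>. iexp (\<xi> \<bullet> W t \<omega>) \<partial>completion M) =
                mittag_leffler \<beta>
                  (- complex_of_real (t powr \<beta> * norm \<xi> powr (2 * \<theta>))
                   - complex_of_real (t powr \<beta>)
                       * (- \<i> * complex_of_real (\<xi> \<bullet> a)) powr complex_of_real \<alpha>))"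
proof (intro allI impI)
  fix t :: real assume t: "0 < t"
  interpret prob_space M by fact
  note indep = \<open>independent_processes M S H L\<close>
  note L_dens = assms(17)[OF t]
  have S_levy: "levy_process M S" and H_levy: "levy_process M H"
    using assms(10,11) by (auto simp: isotropic_stable_process_def stable_subordinator_def)
  have S_meas: "S z \<in> borel_measurable M" and H_meas: "H z \<in> borel_measurable M" if "0 \<le> z" for z
    using S_levy H_levy that by (auto simp: levy_process_def)
  have H_nonneg: "AE \<omega> in M. 0 \<le> H z \<omega>" if "0 \<le> z" for z
    using assms(11) by (rule stable_subordinator_nonneg) fact
  have L_pos: "AE \<omega> in M. 0 < L t \<omega>"
    and L_exp: "\<And>c. (\<integral>\<omega>. exp (c * of_real (L t \<omega>)) \<partial>M) = mittag_leffler \<beta> (c * of_real (t powr \<beta>))"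
    using inverse_process_mittag_leffler[OF _ assms(12) t, of "\<lambda>z. l z t"] assms(6,13) L_dens by auto
  \<comment> \<open>Sample space with the events of \<open>S\<close> and \<open>H\<close> only, which is independent of the random time.\<close>
  define N where "N = sigma (space M) (process_events M S \<union> process_events M H)"
  note time = independent_time_product_law[OF indep less_imp_le[OF t], folded N_def]
  note [measurable] = time(1,2)
  have N_meas: "S z \<in> borel_measurable N" "H z \<in> borel_measurable N" if "0 \<le> z" for z
    using that process_events_subset_Pow[of M S] process_events_subset_Pow[of M H]
    unfolding N_def by (auto intro!: measurable_sigma_process_events)
  define Z where "Z p = right_limit_version S (fst p) (snd p) + right_limit_version H (fst p) (snd p) *\<^sub>R a" for p
  note [measurable] = measurable_right_limit_version[of S N, OF N_meas(1)] measurable_right_limit_version[of H N, OF N_meas(2)]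
  have Z_meas [measurable]: "Z \<in> borel_measurable (borel \<Otimes>\<^sub>M N)"
    unfolding Z_def by measurable
  have cadlag: "AE \<omega> in M. cadlag (\<lambda>t. S t \<omega>) \<and> cadlag (\<lambda>t. H t \<omega>)"
    using S_levy H_levy by (auto simp: levy_process_def)
  have Z_eq: "AE \<omega> in M. Z (z, \<omega>) = S z \<omega> + H z \<omega> *\<^sub>R a" if "0 \<le> z" for z
    using cadlag by eventually_elim (simp add: Z_def right_limit_version_eq that)
  have W_eq: "AE \<omega> in M. W t \<omega> = Z (L t \<omega>, \<omega>)"
    using cadlag L_pos
    by eventually_elim (simp add: \<open>W = _\<close> Z_def right_limit_version_eq)
  have W'_meas [measurable]: "(\<lambda>\<omega>. Z (L t \<omega>, \<omega>)) \<in> borel_measurable M"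
    by measurable
  have W_meas [measurable]: "W t \<in> borel_measurable (completion M)"
    by (rule measurable_completion_AE_eq[OF W'_meas W_eq]) simp
  have sections [measurable]: "(\<lambda>\<omega>. Z (z, \<omega>)) \<in> borel_measurable M" for z
    by measurable
  have law_W: "distr (completion M) lborel (W t) = distr M lborel (\<lambda>\<omega>. Z (L t \<omega>, \<omega>))"
  proof -
    have "distr (completion M) lborel (W t) = distr (completion M) lborel (\<lambda>\<omega>. Z (L t \<omega>, \<omega>))"
      using W_meas measurable_completion[OF W'_meas] AE_completion[OF W_eq]
      by (intro distr_cong_AE) auto
    then show ?thesis by (simp add: distr_completion)
  qed
  have S_dens: "distributed M lborel (S z) (\<lambda>x. T x z)"
    and H_dens: "distributed M lborel (H z) (\<lambda>r. h r z)" if "0 < z" for z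
    using assms(15,16) that by (auto simp: has_process_density_def)
  note [measurable] = distributed_borel_measurable[OF L_dens]
  have l_meas [measurable]: "(\<lambda>z. l z t) \<in> borel_measurable borel"
    using distributed_borel_measurable[OF L_dens] by simp
  note w = w_distribution_Tonelli[where T=T and h=h and l=l and t=t, OF process_density_borel_measurable[OF assms(15)]
      process_density_borel_measurable[OF assms(16)] l_meas assms(8)]
  have L_supp: "AE z in lborel. l z t \<noteq> 0 \<longrightarrow> 0 < z"
    using L_dens L_pos by (rule distributed_AE_support) simp
  have density: "distr M lborel (\<lambda>\<omega>. Z (L t \<omega>, \<omega>)) = density lborel (\<lambda>x. w_distribution T h l a x t)"
  proof (rule measure_eqI)
    fix A assume "A \<in> sets (distr M lborel (\<lambda>\<omega>. Z (L t \<omega>, \<omega>)))"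
    then have A [measurable]: "A \<in> sets borel" by simp
    \<comment> \<open>Probability that the drifted process at the fixed time \<open>z\<close> lies in \<open>A\<close>.\<close>
    define \<Phi> where "\<Phi> z = (\<integral>\<^sup>+\<omega>. indicator A (Z (z, \<omega>)) \<partial>M)" for z
    have \<Phi>_meas [measurable]: "\<Phi> \<in> borel_measurable borel"
    proof -
      have "\<Phi> = (\<lambda>z. \<integral>\<^sup>+\<omega>. indicator A (Z (z, \<omega>)) \<partial>distr M N (\<lambda>\<omega>. \<omega>))"
        unfolding \<Phi>_def by (intro ext, subst nn_integral_distr) simp_all
      moreover interpret N: prob_space "distr M N (\<lambda>\<omega>. \<omega>)" by (rule prob_space_distr) simp
      have "(\<lambda>z. \<integral>\<^sup>+\<omega>. indicator A (Z (z, \<omega>)) \<partial>distr M N (\<lambda>\<omega>. \<omega>)) \<in> borel_measurable borel"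
        by measurable
      ultimately show ?thesis by simp
    qed
    have \<Phi>_eq: "\<Phi> z = (\<integral>\<^sup>+x. T x z * (\<integral>\<^sup>+r. h r z * (indicator {0<..} r * indicator A (x + r *\<^sub>R a)) \<partial>lborel) \<partial>lborel)"
      if z: "0 < z" for z
    proof -
      note [measurable] = S_meas[OF less_imp_le[OF z]] H_meas[OF less_imp_le[OF z]]
      have [measurable]: "(\<lambda>r. h r z) \<in> borel_measurable borel"
        using distributed_borel_measurable[OF H_dens[OF z]] by simp
      have H_supp: "AE r in lborel. h r z \<noteq> 0 \<longrightarrow> 0 < r"
      proof -
        have "AE r in lborel. h r z \<noteq> 0 \<longrightarrow> 0 \<le> r"
          using H_dens[OF z] H_nonneg[OF less_imp_le[OF z]] by (rule distributed_AE_support) simp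
        with AE_lborel_singleton[of 0] show ?thesis by eventually_elim auto
      qed
      have inner: "(\<integral>\<^sup>+\<omega>. indicator A (x + H z \<omega> *\<^sub>R a) \<partial>M)
        = (\<integral>\<^sup>+r. h r z * (indicator {0<..} r * indicator A (x + r *\<^sub>R a)) \<partial>lborel)" for x
      proof -
        have "(\<integral>\<^sup>+\<omega>. indicator A (x + H z \<omega> *\<^sub>R a) \<partial>M) = (\<integral>\<^sup>+r. h r z * indicator A (x + r *\<^sub>R a) \<partial>lborel)"
          by (rule distributed_nn_integral[OF H_dens[OF z], symmetric]) simp
        also have "\<dots> = (\<integral>\<^sup>+r. h r z * (indicator {0<..} r * indicator A (x + r *\<^sub>R a)) \<partial>lborel)"
          using H_supp by (intro nn_integral_cong_AE, eventually_elim) (auto simp: indicator_def)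
        finally show ?thesis .
      qed
      have "\<Phi> z = (\<integral>\<^sup>+\<omega>. indicator A (S z \<omega> + H z \<omega> *\<^sub>R a) \<partial>M)"
        unfolding \<Phi>_def using Z_eq[OF less_imp_le[OF z]]
        by (intro nn_integral_cong_AE, eventually_elim) simp
      also have "\<dots> = (\<integral>\<^sup>+x. (\<integral>\<^sup>+\<omega>. indicator A (x + H z \<omega> *\<^sub>R a) \<partial>M) \<partial>distr M borel (S z))"
        using product_law_nn_integral[where f="\<lambda>p. indicator A (fst p + snd p *\<^sub>R a)",
          OF _ _ independent_processes_product_law[OF indep]] z by simp
      also have "\<dots> = (\<integral>\<^sup>+\<omega>'. (\<integral>\<^sup>+r. h r z * (indicator {0<..} r * indicator A (S z \<omega>' + r *\<^sub>R a)) \<partial>lborel) \<partial>M)"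
        unfolding inner by (subst nn_integral_distr) simp_all
      also have "\<dots> = (\<integral>\<^sup>+x. T x z * (\<integral>\<^sup>+r. h r z * (indicator {0<..} r * indicator A (x + r *\<^sub>R a)) \<partial>lborel) \<partial>lborel)"
        by (rule distributed_nn_integral[OF S_dens[OF z], symmetric]) simp
      finally show ?thesis .
    qed
    have "emeasure (distr M lborel (\<lambda>\<omega>. Z (L t \<omega>, \<omega>))) A = (\<integral>\<^sup>+\<omega>. indicator A (Z (L t \<omega>, \<omega>)) \<partial>M)"
      by (subst nn_integral_indicator[symmetric], simp, subst nn_integral_distr) simp_all
    also have "\<dots> = (\<integral>\<^sup>+z. \<Phi> z \<partial>distr M borel (L t))"
      unfolding \<Phi>_def
      by (rule product_law_nn_integral[where f="\<lambda>p. indicator A (Z p)", OF time(2,1,3)]) simp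
    also have "\<dots> = (\<integral>\<^sup>+\<omega>. \<Phi> (L t \<omega>) \<partial>M)"
      by (subst nn_integral_distr) simp_all
    also have "\<dots> = (\<integral>\<^sup>+z. l z t * \<Phi> z \<partial>lborel)"
      by (rule distributed_nn_integral[OF L_dens, symmetric]) simp
    also have "\<dots> = (\<integral>\<^sup>+z. l z t * (indicator {0<..} z * (\<integral>\<^sup>+x. T x z * (\<integral>\<^sup>+r. h r z * (indicator {0<..} r * indicator A (x + r *\<^sub>R a)) \<partial>lborel) \<partial>lborel)) \<partial>lborel)"
      using L_supp by (intro nn_integral_cong_AE, eventually_elim) (auto simp: \<Phi>_eq indicator_def)
    also have "\<dots> = (\<integral>\<^sup>+x. w_distribution T h l a x t * indicator A x \<partial>lborel)"
      by (rule w(2)[OF A, symmetric])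
    also have "\<dots> = emeasure (density lborel (\<lambda>x. w_distribution T h l a x t)) A"
      using w(1) by (subst emeasure_density) simp_all
    finally show "emeasure (distr M lborel (\<lambda>\<omega>. Z (L t \<omega>, \<omega>))) A
      = emeasure (density lborel (\<lambda>x. w_distribution T h l a x t)) A" .
  qed simp
  have char: "(\<integral>\<omega>. iexp (\<xi> \<bullet> W t \<omega>) \<partial>completion M) =
      mittag_leffler \<beta>
        (- complex_of_real (t powr \<beta> * norm \<xi> powr (2 * \<theta>))
         - complex_of_real (t powr \<beta>) * (- \<i> * complex_of_real (\<xi> \<bullet> a)) powr complex_of_real \<alpha>)" for \<xi>
  proof -
    \<comment> \<open>Characteristic exponent: at the fixed time \<open>z\<close> the characteristic function is \<open>exp (c z)\<close>.\<close>
    define c where "c = - complex_of_real (norm \<xi> powr (2 * \<theta>)) - (- \<i> * complex_of_real (\<xi> \<bullet> a)) powr complex_of_real \<alpha>"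
    have fixed_time: "(\<integral>\<omega>. iexp (\<xi> \<bullet> Z (z, \<omega>)) \<partial>M) = exp (c * of_real z)" if z: "0 < z" for z
    proof -
      note [measurable] = S_meas[OF less_imp_le[OF z]] H_meas[OF less_imp_le[OF z]]
      have char_S: "(\<integral>\<omega>. iexp (\<xi> \<bullet> S z \<omega>) \<partial>M) = exp (- of_real z * complex_of_real (norm \<xi> powr (2 * \<theta>)))"
        using assms(10) z by (simp add: isotropic_stable_process_def flip: exp_of_real)
      have char_H: "(\<integral>\<omega>. iexp ((\<xi> \<bullet> a) * H z \<omega>) \<partial>M)
        = exp (- of_real z * (- \<i> * of_real (\<xi> \<bullet> a)) powr of_real \<alpha>)"
      proof (rule char_of_stable_laplace)
        show "AE \<omega> in M. 0 \<le> H z \<omega>" using z by (intro H_nonneg) simp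
        show "(\<integral>\<omega>. exp (- \<zeta> * H z \<omega>) \<partial>M) = exp (- z * \<zeta> powr \<alpha>)" if "0 < \<zeta>" for \<zeta>
          using assms(11)[unfolded stable_subordinator_def, THEN conjunct2, THEN conjunct2, rule_format, of z \<zeta>] that z
          by simp
      qed (use \<open>0 < \<alpha>\<close> in simp_all)
      have "(\<integral>\<omega>. iexp (\<xi> \<bullet> Z (z, \<omega>)) \<partial>M) = (\<integral>\<omega>. iexp (\<xi> \<bullet> (S z \<omega> + H z \<omega> *\<^sub>R a)) \<partial>M)"
      proof (rule integral_cong_AE)
        show "AE \<omega> in M. iexp (\<xi> \<bullet> Z (z, \<omega>)) = iexp (\<xi> \<bullet> (S z \<omega> + H z \<omega> *\<^sub>R a))"
          using Z_eq[OF less_imp_le[OF z]] by eventually_elim simp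
      qed simp_all
      also have "\<dots> = (\<integral>x. (\<integral>\<omega>. iexp (\<xi> \<bullet> (x + H z \<omega> *\<^sub>R a)) \<partial>M) \<partial>distr M borel (S z))"
        using product_law_integral[where g="\<lambda>p. iexp (\<xi> \<bullet> (fst p + snd p *\<^sub>R a))" and c=1,
          OF _ _ independent_processes_product_law[OF indep]] z by simp
      also have "\<dots> = (\<integral>x. iexp (\<xi> \<bullet> x) * (\<integral>\<omega>. iexp ((\<xi> \<bullet> a) * H z \<omega>) \<partial>M) \<partial>distr M borel (S z))"
      proof (intro Bochner_Integration.integral_cong refl)
        fix x
        have "iexp (\<xi> \<bullet> (x + H z \<omega> *\<^sub>R a)) = iexp (\<xi> \<bullet> x) * iexp ((\<xi> \<bullet> a) * H z \<omega>)" for \<omega>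
          by (simp add: inner_add_right exp_add[symmetric] algebra_simps)
        then show "(\<integral>\<omega>. iexp (\<xi> \<bullet> (x + H z \<omega> *\<^sub>R a)) \<partial>M) = iexp (\<xi> \<bullet> x) * (\<integral>\<omega>. iexp ((\<xi> \<bullet> a) * H z \<omega>) \<partial>M)"
          by (simp only: Bochner_Integration.integral_mult_right_zero)
      qed
      also have "\<dots> = (\<integral>x. iexp (\<xi> \<bullet> x) \<partial>distr M borel (S z)) * (\<integral>\<omega>. iexp ((\<xi> \<bullet> a) * H z \<omega>) \<partial>M)"
        by (rule Bochner_Integration.integral_mult_left_zero)
      also have "(\<integral>x. iexp (\<xi> \<bullet> x) \<partial>distr M borel (S z)) = (\<integral>\<omega>. iexp (\<xi> \<bullet> S z \<omega>) \<partial>M)"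
        by (rule integral_distr) simp_all
      also have "\<dots> * (\<integral>\<omega>. iexp ((\<xi> \<bullet> a) * H z \<omega>) \<partial>M) = exp (c * of_real z)"
        unfolding char_S char_H by (simp add: c_def exp_add[symmetric] algebra_simps)
      finally show ?thesis .
    qed
    have "(\<integral>\<omega>. iexp (\<xi> \<bullet> W t \<omega>) \<partial>completion M) = (\<integral>\<omega>. iexp (\<xi> \<bullet> Z (L t \<omega>, \<omega>)) \<partial>completion M)"
    proof (rule integral_cong_AE)
      show "(\<lambda>\<omega>. iexp (\<xi> \<bullet> Z (L t \<omega>, \<omega>))) \<in> borel_measurable (completion M)"
        by (intro measurable_completion) simp
      show "AE \<omega> in completion M. iexp (\<xi> \<bullet> W t \<omega>) = iexp (\<xi> \<bullet> Z (L t \<omega>, \<omega>))"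
        using AE_completion[OF W_eq] by eventually_elim simp
    qed simp
    also have "\<dots> = (\<integral>\<omega>. iexp (\<xi> \<bullet> Z (L t \<omega>, \<omega>)) \<partial>M)"
      by (rule integral_completion) simp
    also have "\<dots> = (\<integral>z. (\<integral>\<omega>. iexp (\<xi> \<bullet> Z (z, \<omega>)) \<partial>M) \<partial>distr M borel (L t))"
      by (rule product_law_integral[where g="\<lambda>p. iexp (\<xi> \<bullet> Z p)" and c=1, OF time(2,1,3)]) simp_all
    also have "\<dots> = (\<integral>z. exp (c * of_real z) \<partial>distr M borel (L t))"
    proof (rule integral_cong_AE)
      show "(\<lambda>z. \<integral>\<omega>. iexp (\<xi> \<bullet> Z (z, \<omega>)) \<partial>M) \<in> borel_measurable (distr M borel (L t))"
      proof -
        interpret N: prob_space "distr M N (\<lambda>\<omega>. \<omega>)" by (rule prob_space_distr) simp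
        have "(\<lambda>z. \<integral>\<omega>. iexp (\<xi> \<bullet> Z (z, \<omega>)) \<partial>distr M N (\<lambda>\<omega>. \<omega>)) \<in> borel_measurable borel"
          by measurable
        moreover have "(\<integral>\<omega>. iexp (\<xi> \<bullet> Z (z, \<omega>)) \<partial>distr M N (\<lambda>\<omega>. \<omega>)) = (\<integral>\<omega>. iexp (\<xi> \<bullet> Z (z, \<omega>)) \<partial>M)" for z
          by (rule integral_distr) simp_all
        ultimately show ?thesis by simp
      qed
      have "AE z in distr M borel (L t). 0 < z"
        using L_pos by (subst AE_distr_iff) auto
      then show "AE z in distr M borel (L t). (\<integral>\<omega>. iexp (\<xi> \<bullet> Z (z, \<omega>)) \<partial>M) = exp (c * of_real z)"
        by eventually_elim (rule fixed_time)
    qed simp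
    also have "\<dots> = (\<integral>\<omega>. exp (c * of_real (L t \<omega>)) \<partial>M)"
      by (rule integral_distr) simp_all
    also have "\<dots> = mittag_leffler \<beta> (c * of_real (t powr \<beta>))" by (rule L_exp)
    finally show ?thesis by (simp add: c_def algebra_simps)
  qed
  show "distributed (completion M) lborel (W t) (\<lambda>x. w_distribution T h l a x t) \<and>
      (\<forall>\<xi>. (\<integral>\<omega>. iexp (\<xi> \<bullet> W t \<omega>) \<partial>completion M) =
        mittag_leffler \<beta>
          (- complex_of_real (t powr \<beta> * norm \<xi> powr (2 * \<theta>))
           - complex_of_real (t powr \<beta>) * (- \<i> * complex_of_real (\<xi> \<bullet> a)) powr complex_of_real \<alpha>))"
    using char W_meas w(1) by (auto simp: distributed_def law_W density)
qed

end
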